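(* Suppose that $\beta_3\ne 0$, that $\gamma_1^{-2n_1/n}\gamma_2\gamma_3\neq q^{vn_1}$ for any integer $v$, and that $(\gamma_1^{n_1}-\gamma_2^n)\beta_1=(\gamma_1^{n_1}-\gamma_3^n)\beta_2=0$. Then $\mathrm{Ext}^1_{H_\beta}\bigl(V_t(\gamma_1,\gamma_2,\gamma_3;i-t+n),V_t(\gamma_1,\gamma_2,\gamma_3;i)\bigr)\neq0$ for all $1\le i\le n-1$, where $t=|q^{n_1}|$ is the order of $q^{n_1}$.
   Context: Let $\mathbf{K}$ be an algebraically closed field of characteristic zero, $\mathbf{K}^*=\mathbf{K}\setminus\{0\}$, $n\ge 2$, $q\in\mathbf{K}$ a primitive $n$-th root of unity, $n_1$ an integer with $1\le n_1\le n$ and $2\nmid (n,n_1)$. For $\beta=(\beta_1,\beta_2,\beta_3)\in\mathbf{K}^3$, $H_\beta$ is the $\mathbf{K}$-algebra generated by invertible $a,b,c$ and by $x,y$ with relations $ab=ba$, $ac=ca$, $bc=cb$, $xa=qax$, $ya=q^{-1}ay$, $bx=xb$, $cx=xc$, $by=yb$, $cy=yc$, $yx-q^{-n_1}xy=\beta_3(a^{2n_1}-bc)$, $x^n=\beta_1(a^{nn_1}-b^n)$, $y^n=\beta_2(a^{nn_1}-c^n)$. Let $\gamma_1,\gamma_2,\gamma_3\in\mathbf{K}^*$; fix an $n$-th root $\sqrt[n]{\gamma_1}$ and write $\gamma_1^{2n_1/n}=(\sqrt[n]{\gamma_1})^{2n_1}$. Under the stated conditions on $\gamma_1,\gamma_2,\gamma_3$,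 for an integer $i$ (which matters only modulo $n$), $V_t(\gamma_1,\gamma_2,\gamma_3;i)$ is the irreducible $H_\beta$-module with basis $m_0,\dots,m_{t-1}$ and $am_j=\sqrt[n]{\gamma_1}q^{i-j}m_j$, $bm_j=\gamma_2m_j$, $cm_j=\gamma_3m_j$; $xm_j=m_{j+1}$ ($0\le j\le t-2$), $xm_{t-1}=0$; $ym_0=0$, $ym_l=k_lm_{l-1}$ with $k_l=\sum_{j=0}^{l-1}q^{-jn_1}\beta_3(q^{(2i-l+1)n_1}\gamma_1^{2n_1/n}-\gamma_2\gamma_3)$ for $1\le l\le t-1$. *)

theory Defs
  imports
    "HOL-Algebra.Algebra"
    "HOL-Algebra.Algebraic_Closure_Type"
    "HOL-Library.Poly_Mapping"
    "HOL-Computational_Algebra.Computational_Algebra"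
begin

section \<open>Left modules over a not necessarily commutative ring\<close>

text \<open>The locale \<^locale>\<open>module\<close> of the library requires a commutative ring of scalars; only its
  record type is reused. The fields \<^const>\<open>monoid.mult\<close> and \<^const>\<open>monoid.one\<close> of that
  record play no role for a module.\<close>

locale left_module = R?: ring R + M?: abelian_group M
  for R :: "('r, 'u) ring_scheme" (structure) and M :: "('r, 'a, 'v) module_scheme" (structure) +
  assumes smult_closed:
      "\<lbrakk>r \<in> carrier R; x \<in> carrier M\<rbrakk> \<Longrightarrow> r \<odot>\<^bsub>M\<^esub> x \<in> carrier M"
    and smult_l_distr:
      "\<lbrakk>r \<in> carrier R; s \<in> carrier R; x \<in> carrier M\<rbrakk> \<Longrightarrow>
        (r \<oplus>\<^bsub>R\<^esub> s) \<odot>\<^bsub>M\<^esub> x = r \<odot>\<^bsub>M\<^esub> x \<oplus>\<^bsub>M\<^esub> s \<odot>\<^bsub>M\<^esub> x"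
    and smult_r_distr:
      "\<lbrakk>r \<in> carrier R; x \<in> carrier M; y \<in> carrier M\<rbrakk> \<Longrightarrow>
        r \<odot>\<^bsub>M\<^esub> (x \<oplus>\<^bsub>M\<^esub> y) = r \<odot>\<^bsub>M\<^esub> x \<oplus>\<^bsub>M\<^esub> r \<odot>\<^bsub>M\<^esub> y"
    and smult_assoc:
      "\<lbrakk>r \<in> carrier R; s \<in> carrier R; x \<in> carrier M\<rbrakk> \<Longrightarrow>
        (r \<otimes>\<^bsub>R\<^esub> s) \<odot>\<^bsub>M\<^esub> x = r \<odot>\<^bsub>M\<^esub> (s \<odot>\<^bsub>M\<^esub> x)"
    and smult_one: "x \<in> carrier M \<Longrightarrow> \<one>\<^bsub>R\<^esub> \<odot>\<^bsub>M\<^esub> x = x"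

text \<open>The abelian group of \<open>R\<close>-linear maps, written multiplicatively (as \<^typ>\<open>'a monoid\<close>)
  so that the quotient construction \<^const>\<open>FactGroup\<close> applies to it.\<close>

definition Hom_module ::
  "('r, 'u) ring_scheme \<Rightarrow> ('r, 'a, 'v) module_scheme \<Rightarrow> ('r, 'b, 'w) module_scheme \<Rightarrow> ('a \<Rightarrow> 'b) monoid"
  where
  "Hom_module R A B =
    \<lparr>carrier = {f \<in> carrier A \<rightarrow>\<^sub>E carrier B.
        (\<forall>x\<in>carrier A. \<forall>y\<in>carrier A. f (x \<oplus>\<^bsub>A\<^esub> y) = f x \<oplus>\<^bsub>B\<^esub> f y) \<and>
        (\<forall>r\<in>carrier R. \<forall>x\<in>carrier A. f (r \<odot>\<^bsub>A\<^esub> x) = r \<odot>\<^bsub>B\<^esub> f x)},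
     monoid.mult = (\<lambda>f g. \<lambda>x\<in>carrier A. f x \<oplus>\<^bsub>B\<^esub> g x),
     monoid.one = (\<lambda>x\<in>carrier A. \<zero>\<^bsub>B\<^esub>)\<rparr>"


section \<open>The first extension group\<close>

text \<open>\<open>free_cover R M\<close> is the free left \<open>R\<close>-module on the underlying set of \<open>M\<close> (finitely
  supported functions), \<open>cover_map R M\<close> its canonical surjection onto \<open>M\<close>, and
  \<open>syzygy R M\<close> the kernel of that surjection.\<close>

definition free_cover ::
  "('r, 'u) ring_scheme \<Rightarrow> ('r, 'a, 'v) module_scheme \<Rightarrow> ('r, 'a \<Rightarrow> 'r) module" where
  "free_cover R M =
    \<lparr>carrier = {f. (\<forall>x\<in>carrier M. f x \<in> carrier R) \<and> (\<forall>x. x \<notin> carrier M \<longrightarrow> f x = \<zero>\<^bsub>R\<^esub>) \<and>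
        finite {x. f x \<noteq> \<zero>\<^bsub>R\<^esub>}},
     monoid.mult = undefined, monoid.one = undefined,
     ring.zero = (\<lambda>x. \<zero>\<^bsub>R\<^esub>), ring.add = (\<lambda>f g x. f x \<oplus>\<^bsub>R\<^esub> g x),
     module.smult = (\<lambda>r f x. r \<otimes>\<^bsub>R\<^esub> f x)\<rparr>"

definition cover_map ::
  "('r, 'u) ring_scheme \<Rightarrow> ('r, 'a, 'v) module_scheme \<Rightarrow> ('a \<Rightarrow> 'r) \<Rightarrow> 'a" where
  "cover_map R M f = (\<Oplus>\<^bsub>M\<^esub>x\<in>{x. f x \<noteq> \<zero>\<^bsub>R\<^esub>}. f x \<odot>\<^bsub>M\<^esub> x)"

definition syzygy ::
  "('r, 'u) ring_scheme \<Rightarrow> ('r, 'a, 'v) module_scheme \<Rightarrow> ('r, 'a \<Rightarrow> 'r) module" where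
  "syzygy R M = (free_cover R M)
    \<lparr>carrier := {f \<in> carrier (free_cover R M). cover_map R M f = \<zero>\<^bsub>M\<^esub>}\<rparr>"

text \<open>Iterating, one obtains the canonical free resolution
  \<open>\<dots> \<rightarrow> F\<^sub>2 \<rightarrow> F\<^sub>1 \<rightarrow> F\<^sub>0 \<rightarrow> M \<rightarrow> 0\<close> with
  \<open>F\<^sub>k = free_cover R (\<Omega>\<^sup>k M)\<close>, where \<open>\<Omega> = syzygy R\<close>; its differentials
  \<open>F\<^sub>1 \<rightarrow> \<Omega> M \<subseteq> F\<^sub>0\<close> and \<open>F\<^sub>2 \<rightarrow> \<Omega> (\<Omega> M) \<subseteq> F\<^sub>1\<close> are the cover maps of \<open>\<Omega> M\<close> and
  \<open>\<Omega> (\<Omega> M)\<close>. The first cohomology of the complex \<open>Hom\<^sub>R (F, N)\<close> is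
  the value at \<open>M\<close> of the first right derived functor of \<open>Hom\<^sub>R (-, N)\<close>.\<close>

definition Ext1_cocycles ::
  "('r, 'u) ring_scheme \<Rightarrow> ('r, 'a, 'v) module_scheme \<Rightarrow> ('r, 'b, 'w) module_scheme \<Rightarrow>
    ((('a \<Rightarrow> 'r) \<Rightarrow> 'r) \<Rightarrow> 'b) set" where
  "Ext1_cocycles R M N =
    {f \<in> carrier (Hom_module R (free_cover R (syzygy R M)) N).
      \<forall>z\<in>carrier (free_cover R (syzygy R (syzygy R M))).
        f (cover_map R (syzygy R (syzygy R M)) z) = \<zero>\<^bsub>N\<^esub>}"

definition Ext1_coboundaries ::
  "('r, 'u) ring_scheme \<Rightarrow> ('r, 'a, 'v) module_scheme \<Rightarrow> ('r, 'b, 'w) module_scheme \<Rightarrow>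
    ((('a \<Rightarrow> 'r) \<Rightarrow> 'r) \<Rightarrow> 'b) set" where
  "Ext1_coboundaries R M N =
    (\<lambda>g. compose (carrier (free_cover R (syzygy R M))) g (cover_map R (syzygy R M))) `
      carrier (Hom_module R (free_cover R M) N)"

definition Ext1 ::
  "('r, 'u) ring_scheme \<Rightarrow> ('r, 'a, 'v) module_scheme \<Rightarrow> ('r, 'b, 'w) module_scheme \<Rightarrow>
    ((('a \<Rightarrow> 'r) \<Rightarrow> 'r) \<Rightarrow> 'b) set monoid" where
  "Ext1 R M N =
    (Hom_module R (free_cover R (syzygy R M)) N)\<lparr>carrier := Ext1_cocycles R M N\<rparr>
      Mod Ext1_coboundaries R M N"


section \<open>The free algebra on eight generators\<close>

datatype gen = Gen_a | Gen_a_inv | Gen_b | Gen_b_inv | Gen_c | Gen_c_inv | Gen_x | Gen_y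

datatype word = Word (letters: "gen list")

text \<open>Finitely supported functions on a monoid written additively carry the convolution product,
  so with concatenation as addition of words, \<^typ>\<open>word \<Rightarrow>\<^sub>0 'k\<close> is the free
  (noncommutative) algebra.\<close>

instantiation word :: monoid_add
begin
definition zero_word :: word where "0 = Word []"
definition plus_word :: "word \<Rightarrow> word \<Rightarrow> word" where "v + w = Word (letters v @ letters w)"
instance by standard (simp_all add: zero_word_def plus_word_def)
end

definition free_gen :: "gen \<Rightarrow> word \<Rightarrow>\<^sub>0 'k::comm_ring_1" where
  "free_gen u = Poly_Mapping.single (Word [u]) 1"

definition free_const :: "'k \<Rightarrow> word \<Rightarrow>\<^sub>0 'k::comm_ring_1" where
  "free_const \<kappa> = Poly_Mapping.single 0 \<kappa>"

abbreviation free_algebra :: "(word \<Rightarrow>\<^sub>0 'k::comm_ring_1) ring" where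
  "free_algebra \<equiv> ring_of_type_algebra"


section \<open>The algebra \<open>H\<^sub>\<beta>\<close>\<close>

definition H_relators ::
  "nat \<Rightarrow> nat \<Rightarrow> 'k \<Rightarrow> 'k \<Rightarrow> 'k \<Rightarrow> 'k \<Rightarrow> (word \<Rightarrow>\<^sub>0 'k::field) set" where
  "H_relators n n1 q \<beta>1 \<beta>2 \<beta>3 =
    (let a = free_gen Gen_a; a' = free_gen Gen_a_inv;
         b = free_gen Gen_b; b' = free_gen Gen_b_inv;
         c = free_gen Gen_c; c' = free_gen Gen_c_inv;
         x = free_gen Gen_x; y = free_gen Gen_y
     in {a * a' - 1, a' * a - 1, b * b' - 1, b' * b - 1, c * c' - 1, c' * c - 1,
         a * b - b * a, a * c - c * a, b * c - c * b,
         x * a - free_const q * (a * x),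
         y * a - free_const (inverse q) * (a * y),
         b * x - x * b, c * x - x * c, b * y - y * b, c * y - y * c,
         y * x - free_const (inverse (q ^ n1)) * (x * y)
           - free_const \<beta>3 * (a ^ (2 * n1) - b * c),
         x ^ n - free_const \<beta>1 * (a ^ (n * n1) - b ^ n),
         y ^ n - free_const \<beta>2 * (a ^ (n * n1) - c ^ n)})"

definition H_ideal ::
  "nat \<Rightarrow> nat \<Rightarrow> 'k \<Rightarrow> 'k \<Rightarrow> 'k \<Rightarrow> 'k \<Rightarrow> (word \<Rightarrow>\<^sub>0 'k::field) set" where
  "H_ideal n n1 q \<beta>1 \<beta>2 \<beta>3 = Idl\<^bsub>free_algebra\<^esub> (H_relators n n1 q \<beta>1 \<beta>2 \<beta>3)"

definition H_algebra ::
  "nat \<Rightarrow> nat \<Rightarrow> 'k \<Rightarrow> 'k \<Rightarrow> 'k \<Rightarrow> 'k \<Rightarrow> (word \<Rightarrow>\<^sub>0 'k::field) set ring" where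
  "H_algebra n n1 q \<beta>1 \<beta>2 \<beta>3 = free_algebra Quot H_ideal n n1 q \<beta>1 \<beta>2 \<beta>3"

definition H_class ::
  "nat \<Rightarrow> nat \<Rightarrow> 'k \<Rightarrow> 'k \<Rightarrow> 'k \<Rightarrow> 'k \<Rightarrow> (word \<Rightarrow>\<^sub>0 'k) \<Rightarrow> (word \<Rightarrow>\<^sub>0 'k::field) set" where
  "H_class n n1 q \<beta>1 \<beta>2 \<beta>3 p = H_ideal n n1 q \<beta>1 \<beta>2 \<beta>3 +>\<^bsub>free_algebra\<^esub> p"


section \<open>The modules \<open>V\<^sub>t(\<gamma>\<^sub>1, \<gamma>\<^sub>2, \<gamma>\<^sub>3; i)\<close>\<close>

definition primitive_root_of_unity :: "nat \<Rightarrow> 'k::field \<Rightarrow> bool" where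
  "primitive_root_of_unity n q \<longleftrightarrow> 0 < n \<and> q ^ n = 1 \<and> (\<forall>k. 0 < k \<and> k < n \<longrightarrow> q ^ k \<noteq> 1)"

definition mult_order :: "'k::field \<Rightarrow> nat" where
  "mult_order z = (LEAST k. 0 < k \<and> z ^ k = 1)"

text \<open>Here and below, \<open>g\<close> is the chosen \<open>n\<close>-th root of \<open>\<gamma>\<^sub>1\<close>; the modules
  depend on \<open>\<gamma>\<^sub>1\<close> only through \<open>g\<close>.\<close>

definition V_coeff ::
  "nat \<Rightarrow> 'k \<Rightarrow> 'k \<Rightarrow> 'k \<Rightarrow> 'k \<Rightarrow> 'k \<Rightarrow> int \<Rightarrow> nat \<Rightarrow> 'k::field" where
  "V_coeff n1 q \<beta>3 g \<gamma>2 \<gamma>3 i l =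
    (\<Sum>j<l. q powi (- (int j * int n1)) *
      (\<beta>3 * (q powi ((2 * i - int l + 1) * int n1) * g ^ (2 * n1) - \<gamma>2 * \<gamma>3)))"

text \<open>\<open>is_V_module \<dots> t g \<gamma>2 \<gamma>3 i M\<close>: the left \<open>H\<^sub>\<beta>\<close>-module \<open>M\<close> has a
  \<open>K\<close>-basis \<open>m\<^sub>0, \<dots>, m\<^bsub>t-1\<^esub>\<close> on which the generators act by the formulas defining
  \<open>V\<^sub>t(\<gamma>\<^sub>1, \<gamma>\<^sub>2, \<gamma>\<^sub>3; i)\<close>; scalars of \<open>K\<close> act through the constants of \<open>H\<^sub>\<beta>\<close>. This determines \<open>M\<close> up to isomorphism.\<close>

definition is_V_module ::
  "nat \<Rightarrow> nat \<Rightarrow> 'k \<Rightarrow> 'k \<Rightarrow> 'k \<Rightarrow> 'k \<Rightarrow> nat \<Rightarrow> 'k \<Rightarrow> 'k \<Rightarrow> 'k \<Rightarrow> int \<Rightarrow>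
    ((word \<Rightarrow>\<^sub>0 'k::field) set, 'm) module \<Rightarrow> bool" where
  "is_V_module n n1 q \<beta>1 \<beta>2 \<beta>3 t g \<gamma>2 \<gamma>3 i M \<longleftrightarrow>
    left_module (H_algebra n n1 q \<beta>1 \<beta>2 \<beta>3) M \<and>
    (let act = (\<lambda>p v. H_class n n1 q \<beta>1 \<beta>2 \<beta>3 p \<odot>\<^bsub>M\<^esub> v);
         gen = (\<lambda>u v. act (free_gen u) v);
         scal = (\<lambda>\<kappa> v. act (free_const \<kappa>) v)
     in \<exists>m :: nat \<Rightarrow> 'm.
          m \<in> {..<t} \<rightarrow> carrier M \<and>
          (\<forall>v\<in>carrier M. \<exists>!\<kappa>. \<kappa> \<in> {..<t} \<rightarrow>\<^sub>E UNIV \<and> v = (\<Oplus>\<^bsub>M\<^esub>j\<in>{..<t}. scal (\<kappa> j) (m j))) \<and>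
          (\<forall>j<t. gen Gen_a (m j) = scal (g * q powi (i - int j)) (m j)) \<and>
          (\<forall>j<t. gen Gen_b (m j) = scal \<gamma>2 (m j)) \<and>
          (\<forall>j<t. gen Gen_c (m j) = scal \<gamma>3 (m j)) \<and>
          (\<forall>j<t - 1. gen Gen_x (m j) = m (j + 1)) \<and>
          gen Gen_x (m (t - 1)) = \<zero>\<^bsub>M\<^esub> \<and>
          gen Gen_y (m 0) = \<zero>\<^bsub>M\<^esub> \<and>
          (\<forall>l. 1 \<le> l \<and> l \<le> t - 1 \<longrightarrow>
            gen Gen_y (m l) = scal (V_coeff n1 q \<beta>3 g \<gamma>2 \<gamma>3 i l) (m (l - 1))))"

end

theory Submission
  imports Defs
begin

text \<open>
  Write \<open>M\<close> and \<open>N\<close> for the modules with the parameters \<open>i - t + n\<close> and \<open>i\<close>, with bases \<open>m\<^sub>j\<close> and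
  \<open>m'\<^sub>j\<close>. An extension of \<open>M\<close> by \<open>N\<close> with underlying group \<open>N \<times> M\<close> amounts to a
  \<^emph>\<open>crossed map\<close>, that is, a biadditive \<open>D : H\<^sub>\<beta> \<times> M \<rightarrow> N\<close> with \<open>D(rs, v) = r D(s, v) + D(r, sv)\<close>. It does not
  split if there are \<open>r\<close> and \<open>v\<close> such that \<open>rv = 0\<close> but \<open>D(r, v) \<notin> rN\<close>. In terms of the canonical
  free resolution this is \<open>Ext1_nontrivial_of_crossed_map\<close>. A crossed map on the free algebra can be
  prescribed on the generators, and it descends to \<open>H\<^sub>\<beta>\<close> if it vanishes on the relators
  (\<open>Ext1_nontrivial_of_free_crossed\<close>).

  The linear map \<open>\<phi> : M \<rightarrow> N\<close> with \<open>\<phi>(m\<^sub>j) = m'\<^sub>j\<close> commutes with \<open>b\<close>, \<open>c\<close>, \<open>x\<close>, \<open>y\<close>, and it commutes with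
  \<open>a\<close> up to the factor \<open>q\<^bsup>-t\<^esup>\<close>. The order \<open>t\<close> of \<open>q\<^bsup>n\<^sub>1\<^esup>\<close> divides \<open>n\<close>, and there are two cases.

  If \<open>t < n\<close>, then \<open>2t \<le> n\<close>. The weights of \<open>a\<close> on \<open>M\<close> continue those on \<open>N\<close>, so \<open>y m\<^sub>0 = 0\<close> can be
  changed to \<open>y m\<^sub>0 = m'\<^bsub>t-1\<^esub>\<close>; that is, \<open>D(y, v) = x\<^bsup>t-1\<^esup> \<phi>(v)\<close> and \<open>D\<close> is zero at the other generators.
  The relation for \<open>y\<^sup>n\<close> survives because \<open>y\<^sup>t\<close> annihilates both modules and \<open>n - t \<ge> t\<close>. The
  extension does not split because \<open>m'\<^bsub>t-1\<^esub> \<notin> yN\<close>.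

  If \<open>t = n\<close>, then \<open>\<phi>\<close> is an isomorphism and a self-extension of \<open>N\<close> is needed. The algebra \<open>H\<^sub>\<beta>\<close> is
  graded with \<open>a\<close> in degree 1 and \<open>b\<close>, \<open>c\<close>, \<open>x\<close>, \<open>y\<close> in degree \<open>n\<^sub>1\<close>. If \<open>\<partial>\<close> denotes the corresponding
  derivation, then \<open>D(r, v) = \<partial>(r) \<phi>(v)\<close> is a crossed map. It does not split because for
  \<open>r = a - gq\<^sup>i\<close> the vector \<open>D(r, m\<^sub>0) = gq\<^sup>i m'\<^sub>0\<close> is not in \<open>rN\<close>.
\<close>

section \<open>The canonical free cover\<close>

lemma additive_zero:
  assumes "abelian_group A" and "abelian_group B" and "\<phi> \<in> carrier A \<rightarrow> carrier B"
    and "\<And>x y. \<lbrakk>x \<in> carrier A; y \<in> carrier A\<rbrakk> \<Longrightarrow> \<phi> (x \<oplus>\<^bsub>A\<^esub> y) = \<phi> x \<oplus>\<^bsub>B\<^esub> \<phi> y"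
  shows "\<phi> \<zero>\<^bsub>A\<^esub> = \<zero>\<^bsub>B\<^esub>"
proof -
  interpret A: abelian_group A by fact
  interpret B: abelian_group B by fact
  have c: "\<phi> \<zero>\<^bsub>A\<^esub> \<in> carrier B" using assms(3) by auto
  have "\<phi> \<zero>\<^bsub>A\<^esub> \<oplus>\<^bsub>B\<^esub> \<phi> \<zero>\<^bsub>A\<^esub> = \<phi> \<zero>\<^bsub>A\<^esub>"
    using assms(4)[of "\<zero>\<^bsub>A\<^esub>" "\<zero>\<^bsub>A\<^esub>"] by simp
  then show ?thesis using c by (metis B.add.l_cancel_one')
qed

lemma additive_finsum:
  assumes "abelian_group A" and "abelian_group B" and "\<phi> \<in> carrier A \<rightarrow> carrier B"
    and "\<And>x y. \<lbrakk>x \<in> carrier A; y \<in> carrier A\<rbrakk> \<Longrightarrow> \<phi> (x \<oplus>\<^bsub>A\<^esub> y) = \<phi> x \<oplus>\<^bsub>B\<^esub> \<phi> y"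
    and "finite S" and "f \<in> S \<rightarrow> carrier A"
  shows "\<phi> (\<Oplus>\<^bsub>A\<^esub>s\<in>S. f s) = (\<Oplus>\<^bsub>B\<^esub>s\<in>S. \<phi> (f s))"
proof -
  interpret A: abelian_group A by fact
  interpret B: abelian_group B by fact
  from assms(5,6) show ?thesis
  proof (induction S rule: finite_induct)
    case empty
    show ?case using additive_zero[OF assms(1-4)] by simp
  next
    case (insert s S)
    have cl: "f \<in> S \<rightarrow> carrier A" "f s \<in> carrier A" using insert.prems by auto
    have cl': "(\<lambda>s. \<phi> (f s)) \<in> S \<rightarrow> carrier B" "\<phi> (f s) \<in> carrier B"
      using cl assms(3) by auto
    show ?case
      using insert cl cl' assms(4)[OF cl(2) A.finsum_closed[OF cl(1)]]
      by (simp add: A.finsum_insert B.finsum_insert)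
  qed
qed

lemma (in abelian_monoid) finsum_eq_superset:
  assumes "finite S" and "T \<subseteq> S" and "f \<in> S \<rightarrow> carrier G" and "\<And>s. s \<in> S - T \<Longrightarrow> f s = \<zero>"
  shows "(\<Oplus>s\<in>T. f s) = (\<Oplus>s\<in>S. f s)"
  using assms by (intro add.finprod_mono_neutral_cong_left) auto

lemma (in abelian_group) finsum_single_term:
  assumes "finite S" and "s \<in> S" and "f s \<in> carrier G" and "\<And>u. \<lbrakk>u \<in> S; u \<noteq> s\<rbrakk> \<Longrightarrow> f u = \<zero>"
  shows "(\<Oplus>u\<in>S. f u) = f s"
proof -
  have "(\<Oplus>u\<in>{s}. f u) = (\<Oplus>u\<in>S. f u)"
    using assms by (intro finsum_eq_superset) (auto, metis zero_closed)
  then show ?thesis using assms(3) by (simp add: finsum_insert)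
qed

text \<open>The map \<open>(r, x) \<mapsto> F r x\<close> extended from the elements \<open>r[x]\<close> to all finitely supported
  functions \<open>z = \<Sum> z(x)[x]\<close>. The cover map is the case of scalar multiplication.\<close>

definition lift_sum ::
  "('r, 'u) ring_scheme \<Rightarrow> ('b, 'v) ring_scheme \<Rightarrow> ('r \<Rightarrow> 'a \<Rightarrow> 'b) \<Rightarrow> ('a \<Rightarrow> 'r) \<Rightarrow> 'b" where
  "lift_sum R B F z = (\<Oplus>\<^bsub>B\<^esub>x\<in>{x. z x \<noteq> \<zero>\<^bsub>R\<^esub>}. F (z x) x)"

lemma cover_map_eq_lift_sum: "cover_map R M = lift_sum R M (\<lambda>r x. r \<odot>\<^bsub>M\<^esub> x)"
  by (simp add: fun_eq_iff cover_map_def lift_sum_def)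

lemma free_cover_simps:
  "\<zero>\<^bsub>free_cover R M\<^esub> = (\<lambda>x. \<zero>\<^bsub>R\<^esub>)"
  "f \<oplus>\<^bsub>free_cover R M\<^esub> g = (\<lambda>x. f x \<oplus>\<^bsub>R\<^esub> g x)"
  "r \<odot>\<^bsub>free_cover R M\<^esub> f = (\<lambda>x. r \<otimes>\<^bsub>R\<^esub> f x)"
  by (simp_all add: free_cover_def)

lemma syzygy_simps:
  "\<zero>\<^bsub>syzygy R M\<^esub> = (\<lambda>x. \<zero>\<^bsub>R\<^esub>)"
  "f \<oplus>\<^bsub>syzygy R M\<^esub> g = (\<lambda>x. f x \<oplus>\<^bsub>R\<^esub> g x)"
  "r \<odot>\<^bsub>syzygy R M\<^esub> f = (\<lambda>x. r \<otimes>\<^bsub>R\<^esub> f x)"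
  "f \<in> carrier (syzygy R M) \<longleftrightarrow> f \<in> carrier (free_cover R M) \<and> cover_map R M f = \<zero>\<^bsub>M\<^esub>"
  by (simp_all add: syzygy_def free_cover_def)

lemma free_cover_carrier:
  "f \<in> carrier (free_cover R M) \<longleftrightarrow> (\<forall>x\<in>carrier M. f x \<in> carrier R) \<and>
     (\<forall>x. x \<notin> carrier M \<longrightarrow> f x = \<zero>\<^bsub>R\<^esub>) \<and> finite {x. f x \<noteq> \<zero>\<^bsub>R\<^esub>}"
  by (simp add: free_cover_def)

context left_module
begin

lemma smult_zero: "r \<in> carrier R \<Longrightarrow> r \<odot>\<^bsub>M\<^esub> \<zero>\<^bsub>M\<^esub> = \<zero>\<^bsub>M\<^esub>"
  by (rule additive_zero[OF M.abelian_group_axioms M.abelian_group_axioms])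
    (auto simp: smult_closed smult_r_distr)

lemma zero_smult: "x \<in> carrier M \<Longrightarrow> \<zero>\<^bsub>R\<^esub> \<odot>\<^bsub>M\<^esub> x = \<zero>\<^bsub>M\<^esub>"
  by (rule additive_zero[OF R.abelian_group_axioms M.abelian_group_axioms])
    (auto simp: smult_closed smult_l_distr)

lemma submodule:
  assumes "C \<subseteq> carrier M" and zero: "\<zero>\<^bsub>M\<^esub> \<in> C"
    and add: "\<And>x y. \<lbrakk>x \<in> C; y \<in> C\<rbrakk> \<Longrightarrow> x \<oplus>\<^bsub>M\<^esub> y \<in> C"
    and smult: "\<And>r x. \<lbrakk>r \<in> carrier R; x \<in> C\<rbrakk> \<Longrightarrow> r \<odot>\<^bsub>M\<^esub> x \<in> C"
  shows "left_module R (M\<lparr>carrier := C\<rparr>)"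
proof -
  have C: "x \<in> carrier M" if "x \<in> C" for x using assms(1) that by auto
  have neg: "\<exists>y\<in>C. y \<oplus>\<^bsub>M\<^esub> x = \<zero>\<^bsub>M\<^esub>" if x: "x \<in> C" for x
  proof
    show "(\<ominus>\<^bsub>R\<^esub> \<one>\<^bsub>R\<^esub>) \<odot>\<^bsub>M\<^esub> x \<in> C" using x by (intro smult) auto
    have "(\<ominus>\<^bsub>R\<^esub> \<one>\<^bsub>R\<^esub>) \<odot>\<^bsub>M\<^esub> x \<oplus>\<^bsub>M\<^esub> x = (\<ominus>\<^bsub>R\<^esub> \<one>\<^bsub>R\<^esub> \<oplus>\<^bsub>R\<^esub> \<one>\<^bsub>R\<^esub>) \<odot>\<^bsub>M\<^esub> x"
      using C[OF x] by (subst smult_l_distr) (simp_all add: smult_one)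
    then show "(\<ominus>\<^bsub>R\<^esub> \<one>\<^bsub>R\<^esub>) \<odot>\<^bsub>M\<^esub> x \<oplus>\<^bsub>M\<^esub> x = \<zero>\<^bsub>M\<^esub>"
      using C[OF x] by (simp add: R.l_neg zero_smult)
  qed
  have "abelian_group (M\<lparr>carrier := C\<rparr>)"
    using neg by (intro abelian_groupI) (auto simp: zero add C M.a_ac)
  then show ?thesis
    unfolding left_module_def left_module_axioms_def
    using R.ring_axioms by (auto simp: smult C smult_l_distr smult_r_distr smult_assoc smult_one)
qed

lemma free_cover_value: "f \<in> carrier (free_cover R M) \<Longrightarrow> f x \<in> carrier R"
  by (cases "x \<in> carrier M") (auto simp: free_cover_carrier)

lemma free_cover_support: "f \<in> carrier (free_cover R M) \<Longrightarrow> {x. f x \<noteq> \<zero>\<^bsub>R\<^esub>} \<subseteq> carrier M"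
  by (auto simp: free_cover_carrier)

lemma free_cover_add_closed:
  assumes "f \<in> carrier (free_cover R M)" and "g \<in> carrier (free_cover R M)"
  shows "(\<lambda>x. f x \<oplus>\<^bsub>R\<^esub> g x) \<in> carrier (free_cover R M)"
proof -
  have "{x. f x \<oplus>\<^bsub>R\<^esub> g x \<noteq> \<zero>\<^bsub>R\<^esub>} \<subseteq> {x. f x \<noteq> \<zero>\<^bsub>R\<^esub>} \<union> {x. g x \<noteq> \<zero>\<^bsub>R\<^esub>}" by auto
  moreover have "finite ({x. f x \<noteq> \<zero>\<^bsub>R\<^esub>} \<union> {x. g x \<noteq> \<zero>\<^bsub>R\<^esub>})"
    using assms by (auto simp: free_cover_carrier)
  ultimately have "finite {x. f x \<oplus>\<^bsub>R\<^esub> g x \<noteq> \<zero>\<^bsub>R\<^esub>}" by (rule finite_subset)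
  then show ?thesis using assms by (auto simp: free_cover_carrier)
qed

lemma free_cover_smult_closed:
  assumes "r \<in> carrier R" and "f \<in> carrier (free_cover R M)"
  shows "(\<lambda>x. r \<otimes>\<^bsub>R\<^esub> f x) \<in> carrier (free_cover R M)"
proof -
  have "{x. r \<otimes>\<^bsub>R\<^esub> f x \<noteq> \<zero>\<^bsub>R\<^esub>} \<subseteq> {x. f x \<noteq> \<zero>\<^bsub>R\<^esub>}" using assms(1) by auto
  then have "finite {x. r \<otimes>\<^bsub>R\<^esub> f x \<noteq> \<zero>\<^bsub>R\<^esub>}"
    by (rule finite_subset) (use assms in \<open>auto simp: free_cover_carrier\<close>)
  then show ?thesis using assms by (auto simp: free_cover_carrier)
qed

lemma free_cover_zero_closed: "(\<lambda>x. \<zero>\<^bsub>R\<^esub>) \<in> carrier (free_cover R M)"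
  by (auto simp: free_cover_carrier)

lemma free_cover_module: "left_module R (free_cover R M)"
proof -
  note v = free_cover_value
  have "abelian_group (free_cover R M)"
  proof (rule abelian_groupI; unfold free_cover_simps)
    fix f assume f: "f \<in> carrier (free_cover R M)"
    show "\<exists>g\<in>carrier (free_cover R M). (\<lambda>x. g x \<oplus>\<^bsub>R\<^esub> f x) = (\<lambda>x. \<zero>\<^bsub>R\<^esub>)"
    proof
      show "(\<lambda>x. \<ominus>\<^bsub>R\<^esub> \<one>\<^bsub>R\<^esub> \<otimes>\<^bsub>R\<^esub> f x) \<in> carrier (free_cover R M)"
        using f by (intro free_cover_smult_closed) auto
      show "(\<lambda>x. \<ominus>\<^bsub>R\<^esub> \<one>\<^bsub>R\<^esub> \<otimes>\<^bsub>R\<^esub> f x \<oplus>\<^bsub>R\<^esub> f x) = (\<lambda>x. \<zero>\<^bsub>R\<^esub>)"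
        using f by (auto simp: v R.l_minus R.l_neg)
    qed
  qed (auto simp: free_cover_add_closed free_cover_zero_closed v fun_eq_iff R.a_ac)
  then show ?thesis
    unfolding left_module_def left_module_axioms_def free_cover_simps
    using R.ring_axioms
    by (auto simp: free_cover_smult_closed v fun_eq_iff R.l_distr R.r_distr R.m_assoc)
qed

end

text \<open>A biadditive map from \<open>R \<times> M\<close> to an abelian group \<open>B\<close>. No \<open>R\<close>-linearity is required, so that
  both scalar multiplication and the crossed maps below are instances.\<close>

locale biadditive = R?: left_module R M + B?: abelian_group B
  for R :: "('r, 'u) ring_scheme" (structure) and M :: "('r, 'a, 'v) module_scheme" (structure)
    and B :: "('b, 'w) ring_scheme" (structure) +
  fixes F :: "'r \<Rightarrow> 'a \<Rightarrow> 'b"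
  assumes F_closed: "\<lbrakk>r \<in> carrier R; x \<in> carrier M\<rbrakk> \<Longrightarrow> F r x \<in> carrier B"
    and F_add_left: "\<lbrakk>r \<in> carrier R; s \<in> carrier R; x \<in> carrier M\<rbrakk> \<Longrightarrow>
      F (r \<oplus>\<^bsub>R\<^esub> s) x = F r x \<oplus>\<^bsub>B\<^esub> F s x"
    and F_add_right: "\<lbrakk>r \<in> carrier R; x \<in> carrier M; y \<in> carrier M\<rbrakk> \<Longrightarrow>
      F r (x \<oplus>\<^bsub>M\<^esub> y) = F r x \<oplus>\<^bsub>B\<^esub> F r y"
begin

lemma F_zero_left: "x \<in> carrier M \<Longrightarrow> F \<zero>\<^bsub>R\<^esub> x = \<zero>\<^bsub>B\<^esub>"
  by (rule additive_zero[OF R.abelian_group_axioms B.abelian_group_axioms, where \<phi> = "\<lambda>r. F r x"])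
    (auto simp: F_closed F_add_left)

lemma F_zero_right: "r \<in> carrier R \<Longrightarrow> F r \<zero>\<^bsub>M\<^esub> = \<zero>\<^bsub>B\<^esub>"
  by (rule additive_zero[OF M.abelian_group_axioms B.abelian_group_axioms])
    (auto simp: F_closed F_add_right)

lemma F_finsum_right:
  assumes "r \<in> carrier R" and "finite S" and "f \<in> S \<rightarrow> carrier M"
  shows "F r (\<Oplus>\<^bsub>M\<^esub>s\<in>S. f s) = (\<Oplus>\<^bsub>B\<^esub>s\<in>S. F r (f s))"
  using assms by (intro additive_finsum[OF M.abelian_group_axioms B.abelian_group_axioms])
    (auto simp: F_closed F_add_right)

lemma lift_sum_superset:
  assumes "z \<in> carrier (free_cover R M)" and "finite S" and "{x. z x \<noteq> \<zero>\<^bsub>R\<^esub>} \<subseteq> S" and "S \<subseteq> carrier M"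
  shows "lift_sum R B F z = (\<Oplus>\<^bsub>B\<^esub>x\<in>S. F (z x) x)"
  unfolding lift_sum_def using assms free_cover_value[OF assms(1)]
  by (intro B.finsum_eq_superset) (auto simp: F_closed F_zero_left)

lemma lift_sum_closed:
  assumes "z \<in> carrier (free_cover R M)"
  shows "lift_sum R B F z \<in> carrier B"
  unfolding lift_sum_def
  using free_cover_support[OF assms] free_cover_value[OF assms]
  by (intro B.finsum_closed) (auto simp: F_closed)

lemma lift_sum_add:
  assumes "z \<in> carrier (free_cover R M)" and "z' \<in> carrier (free_cover R M)"
  shows "lift_sum R B F (\<lambda>x. z x \<oplus>\<^bsub>R\<^esub> z' x) = lift_sum R B F z \<oplus>\<^bsub>B\<^esub> lift_sum R B F z'"
proof -
  define S where "S = {x. z x \<noteq> \<zero>\<^bsub>R\<^esub>} \<union> {x. z' x \<noteq> \<zero>\<^bsub>R\<^esub>}"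
  have S: "finite S" "S \<subseteq> carrier M"
    using assms by (auto simp: S_def free_cover_carrier)
  note v = free_cover_value[OF assms(1)] free_cover_value[OF assms(2)]
  have "lift_sum R B F (\<lambda>x. z x \<oplus>\<^bsub>R\<^esub> z' x) = (\<Oplus>\<^bsub>B\<^esub>x\<in>S. F (z x \<oplus>\<^bsub>R\<^esub> z' x) x)"
    using S by (intro lift_sum_superset free_cover_add_closed assms) (auto simp: S_def)
  also have "\<dots> = (\<Oplus>\<^bsub>B\<^esub>x\<in>S. F (z x) x \<oplus>\<^bsub>B\<^esub> F (z' x) x)"
    using S v by (intro B.finsum_cong) (auto simp: F_add_left F_closed simp_implies_def subset_iff)
  also have "\<dots> = (\<Oplus>\<^bsub>B\<^esub>x\<in>S. F (z x) x) \<oplus>\<^bsub>B\<^esub> (\<Oplus>\<^bsub>B\<^esub>x\<in>S. F (z' x) x)"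
    using S v by (intro B.finsum_addf) (auto simp: F_closed)
  also have "\<dots> = lift_sum R B F z \<oplus>\<^bsub>B\<^esub> lift_sum R B F z'"
    using S assms by (simp add: lift_sum_superset[of _ S] S_def)
  finally show ?thesis .
qed

lemma lift_sum_point:
  assumes "r \<in> carrier R" and "x \<in> carrier M"
  shows "lift_sum R B F (\<lambda>y. if y = x then r else \<zero>\<^bsub>R\<^esub>) = F r x"
proof -
  have z: "(\<lambda>y. if y = x then r else \<zero>\<^bsub>R\<^esub>) \<in> carrier (free_cover R M)"
    using assms by (auto simp: free_cover_carrier)
  have "lift_sum R B F (\<lambda>y. if y = x then r else \<zero>\<^bsub>R\<^esub>)
      = (\<Oplus>\<^bsub>B\<^esub>y\<in>{x}. F (if y = x then r else \<zero>\<^bsub>R\<^esub>) y)"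
    using assms by (intro lift_sum_superset[OF z]) (auto split: if_splits)
  also have "\<dots> = F r x"
    using assms by (simp add: B.finsum_insert F_closed)
  finally show ?thesis .
qed

end

context left_module
begin

lemma biadditive_smult: "biadditive R M M (\<lambda>r x. r \<odot>\<^bsub>M\<^esub> x)"
  by unfold_locales (auto simp: smult_closed smult_l_distr smult_r_distr)

interpretation S: biadditive R M M "\<lambda>r x. r \<odot>\<^bsub>M\<^esub> x"
  by (rule biadditive_smult)

lemma cover_map_closed: "z \<in> carrier (free_cover R M) \<Longrightarrow> cover_map R M z \<in> carrier M"
  by (simp add: cover_map_eq_lift_sum S.lift_sum_closed)

lemma cover_map_add:
  "\<lbrakk>z \<in> carrier (free_cover R M); z' \<in> carrier (free_cover R M)\<rbrakk> \<Longrightarrow>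
    cover_map R M (\<lambda>x. z x \<oplus>\<^bsub>R\<^esub> z' x) = cover_map R M z \<oplus>\<^bsub>M\<^esub> cover_map R M z'"
  by (simp add: cover_map_eq_lift_sum S.lift_sum_add)

lemma cover_map_point:
  "\<lbrakk>r \<in> carrier R; x \<in> carrier M\<rbrakk> \<Longrightarrow>
    cover_map R M (\<lambda>y. if y = x then r else \<zero>\<^bsub>R\<^esub>) = r \<odot>\<^bsub>M\<^esub> x"
  by (simp add: cover_map_eq_lift_sum S.lift_sum_point)

lemma cover_map_smult:
  assumes "r \<in> carrier R" and z: "z \<in> carrier (free_cover R M)"
  shows "cover_map R M (\<lambda>x. r \<otimes>\<^bsub>R\<^esub> z x) = r \<odot>\<^bsub>M\<^esub> cover_map R M z"
proof -
  define S where "S = {x. z x \<noteq> \<zero>\<^bsub>R\<^esub>}"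
  have S: "finite S" "S \<subseteq> carrier M" using z by (auto simp: S_def free_cover_carrier)
  note v = free_cover_value[OF z]
  have "cover_map R M (\<lambda>x. r \<otimes>\<^bsub>R\<^esub> z x) = (\<Oplus>\<^bsub>M\<^esub>x\<in>S. (r \<otimes>\<^bsub>R\<^esub> z x) \<odot>\<^bsub>M\<^esub> x)"
    unfolding cover_map_eq_lift_sum using S assms
    by (intro S.lift_sum_superset free_cover_smult_closed) (auto simp: S_def)
  also have "\<dots> = (\<Oplus>\<^bsub>M\<^esub>x\<in>S. r \<odot>\<^bsub>M\<^esub> (z x \<odot>\<^bsub>M\<^esub> x))"
    using S v assms by (intro M.finsum_cong) (auto simp: smult_assoc smult_closed simp_implies_def subset_iff)
  also have "\<dots> = r \<odot>\<^bsub>M\<^esub> (\<Oplus>\<^bsub>M\<^esub>x\<in>S. z x \<odot>\<^bsub>M\<^esub> x)"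
    using S v assms by (intro S.F_finsum_right[symmetric]) (auto simp: smult_closed)
  also have "(\<Oplus>\<^bsub>M\<^esub>x\<in>S. z x \<odot>\<^bsub>M\<^esub> x) = cover_map R M z"
    by (simp add: cover_map_def S_def)
  finally show ?thesis .
qed

lemma syzygy_module: "left_module R (syzygy R M)"
proof -
  interpret F: left_module R "free_cover R M" by (rule free_cover_module)
  show ?thesis
    unfolding syzygy_def
    by (rule F.submodule)
      (auto simp: free_cover_simps free_cover_add_closed free_cover_smult_closed
        free_cover_zero_closed cover_map_add cover_map_smult smult_zero cover_map_def[of _ _ "\<lambda>x. \<zero>"])
qed

end

section \<open>Extensions from crossed maps\<close>

text \<open>A crossed map \<open>D\<close> makes \<open>N \<times> M\<close> an extension of \<open>M\<close> by \<open>N\<close> with action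
  \<open>r(w, v) = (rw + D r v, rv)\<close>. The class of this extension is represented by the cocycle
  \<open>h \<circ> d\<close>, where \<open>d\<close> is the cover map of the syzygy and \<open>h(\<Sum> z(x)[x]) = \<Sum> D (z x) x\<close>. If it were
  the coboundary of \<open>g\<close>, then \<open>h\<close> and \<open>g\<close> would agree on the syzygy; evaluation at the syzygy element
  \<open>r[x]\<close>, where \<open>rx = 0\<close>, would give \<open>D r x = r g([x]) \<in> rN\<close>.\<close>

theorem Ext1_nontrivial_of_crossed_map:
  assumes "left_module R M" and "left_module R N" and "biadditive R M N D"
    and crossed: "\<And>r s x. \<lbrakk>r \<in> carrier R; s \<in> carrier R; x \<in> carrier M\<rbrakk> \<Longrightarrow>
      D (r \<otimes>\<^bsub>R\<^esub> s) x = r \<odot>\<^bsub>N\<^esub> D s x \<oplus>\<^bsub>N\<^esub> D r (s \<odot>\<^bsub>M\<^esub> x)"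
    and r: "r \<in> carrier R" and x: "x \<in> carrier M" and rx: "r \<odot>\<^bsub>M\<^esub> x = \<zero>\<^bsub>M\<^esub>"
    and nonsplit: "\<And>v. v \<in> carrier N \<Longrightarrow> D r x \<noteq> r \<odot>\<^bsub>N\<^esub> v"
  shows "carrier (Ext1 R M N) \<noteq> {\<one>\<^bsub>Ext1 R M N\<^esub>}"
proof -
  interpret M: left_module R M by fact
  interpret N: left_module R N by fact
  interpret D: biadditive R M N D by fact
  interpret S: left_module R "syzygy R M" by (rule M.syzygy_module)
  interpret SS: left_module R "syzygy R (syzygy R M)" by (rule S.syzygy_module)
  let ?S = "syzygy R M" and ?F1 = "free_cover R (syzygy R M)"
  define h where "h = lift_sum R N D"
  have SF: "z \<in> carrier (free_cover R M)" if "z \<in> carrier ?S" for z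
    using that by (simp add: syzygy_simps(4))
  have h_closed: "h z \<in> carrier N" if "z \<in> carrier ?S" for z
    using D.lift_sum_closed[OF SF[OF that]] by (simp add: h_def)
  have h_add: "h (\<lambda>x. z x \<oplus>\<^bsub>R\<^esub> z' x) = h z \<oplus>\<^bsub>N\<^esub> h z'" if "z \<in> carrier ?S" "z' \<in> carrier ?S" for z z'
    using D.lift_sum_add[OF SF SF] that by (simp add: h_def)
  \<comment> \<open>In general \<open>h(sz) = s h(z) + D s (cover_map R M z)\<close>; the last term vanishes on the syzygy.\<close>
  have h_smult: "h (\<lambda>x. s \<otimes>\<^bsub>R\<^esub> z x) = s \<odot>\<^bsub>N\<^esub> h z" if s: "s \<in> carrier R" and z: "z \<in> carrier ?S" for s z
  proof -
    define T where "T = {x. z x \<noteq> \<zero>\<^bsub>R\<^esub>}"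
    have T: "finite T" "T \<subseteq> carrier M"
      using SF[OF z] by (auto simp: T_def free_cover_carrier)
    note v = M.free_cover_value[OF SF[OF z]]
    have Tc: "x \<in> carrier M" if "x \<in> T" for x using T that by auto
    have "h (\<lambda>x. s \<otimes>\<^bsub>R\<^esub> z x) = (\<Oplus>\<^bsub>N\<^esub>x\<in>T. D (s \<otimes>\<^bsub>R\<^esub> z x) x)"
      unfolding h_def using T s SF[OF z]
      by (intro D.lift_sum_superset M.free_cover_smult_closed) (auto simp: T_def)
    also have "\<dots> = (\<Oplus>\<^bsub>N\<^esub>x\<in>T. s \<odot>\<^bsub>N\<^esub> D (z x) x \<oplus>\<^bsub>N\<^esub> D s (z x \<odot>\<^bsub>M\<^esub> x))"
      using v s by (intro N.finsum_cong)
        (auto simp: crossed simp_implies_def Tc D.F_closed N.smult_closed M.smult_closed)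
    also have "\<dots> = (\<Oplus>\<^bsub>N\<^esub>x\<in>T. s \<odot>\<^bsub>N\<^esub> D (z x) x) \<oplus>\<^bsub>N\<^esub> (\<Oplus>\<^bsub>N\<^esub>x\<in>T. D s (z x \<odot>\<^bsub>M\<^esub> x))"
      using v s by (intro N.finsum_addf) (auto simp: Tc D.F_closed N.smult_closed M.smult_closed)
    also have "(\<Oplus>\<^bsub>N\<^esub>x\<in>T. D s (z x \<odot>\<^bsub>M\<^esub> x)) = D s (cover_map R M z)"
      unfolding cover_map_def T_def[symmetric] using T v s
      by (intro D.F_finsum_right[symmetric]) (auto simp: Tc M.smult_closed)
    also have "\<dots> = \<zero>\<^bsub>N\<^esub>"
      using z s by (simp add: syzygy_simps(4) D.F_zero_right)
    also have "(\<Oplus>\<^bsub>N\<^esub>x\<in>T. s \<odot>\<^bsub>N\<^esub> D (z x) x) = s \<odot>\<^bsub>N\<^esub> h z"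
      unfolding h_def lift_sum_def T_def[symmetric] using T v s
      by (intro additive_finsum[OF N.M.abelian_group_axioms N.M.abelian_group_axioms, symmetric])
        (auto simp: Tc N.smult_closed N.smult_r_distr D.F_closed)
    finally show ?thesis
      using s h_closed[OF z] by (simp add: N.smult_closed)
  qed
  have h_zero: "h (\<lambda>x. \<zero>\<^bsub>R\<^esub>) = \<zero>\<^bsub>N\<^esub>"
    by (simp add: h_def lift_sum_def)
  define f where "f = (\<lambda>w\<in>carrier ?F1. h (cover_map R ?S w))"
  have f_hom: "f \<in> carrier (Hom_module R ?F1 N)"
    unfolding Hom_module_def f_def
    by (auto simp: S.cover_map_closed h_closed S.free_cover_add_closed S.free_cover_smult_closed
        free_cover_simps S.cover_map_add S.cover_map_smult syzygy_simps(1-3) h_add h_smult)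
  have f_cocycle: "f \<in> Ext1_cocycles R M N"
  proof -
    have "f (cover_map R (syzygy R ?S) z) = \<zero>\<^bsub>N\<^esub>"
      if "z \<in> carrier (free_cover R (syzygy R ?S))" for z
    proof -
      have "cover_map R (syzygy R ?S) z \<in> carrier (syzygy R ?S)"
        using SS.cover_map_closed[OF that] .
      then show ?thesis
        by (simp add: f_def syzygy_simps(4)[of _ R ?S] syzygy_simps(1) h_zero)
    qed
    then show ?thesis using f_hom by (simp add: Ext1_cocycles_def)
  qed
  have f_not: "f \<notin> Ext1_coboundaries R M N"
  proof
    assume "f \<in> Ext1_coboundaries R M N"
    then obtain g where g: "g \<in> carrier (Hom_module R (free_cover R M) N)"
      and fg: "f = compose (carrier ?F1) g (cover_map R ?S)"
      by (auto simp: Ext1_coboundaries_def)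
    let ?e = "\<lambda>s y. if y = x then s else \<zero>\<^bsub>R\<^esub>"
    have e: "?e s \<in> carrier (free_cover R M)" if "s \<in> carrier R" for s
      using that x by (auto simp: free_cover_carrier)
    have re: "?e r \<in> carrier ?S"
      using r x rx e[OF r] by (simp add: syzygy_simps(4) M.cover_map_point)
    let ?w = "\<lambda>z. if z = ?e r then \<one>\<^bsub>R\<^esub> else \<zero>\<^bsub>R\<^esub>"
    have w: "?w \<in> carrier ?F1" using re by (auto simp: free_cover_carrier)
    have cw: "cover_map R ?S ?w = ?e r"
      using S.cover_map_point[OF M.R.one_closed re] S.smult_one[OF re] by simp
    have "D r x = h (?e r)" using r x by (simp add: h_def D.lift_sum_point)
    also have "\<dots> = f ?w" using w cw by (simp add: f_def)
    also have "\<dots> = g (?e r)" using w cw by (simp add: fg compose_def)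
    also have "?e r = r \<odot>\<^bsub>free_cover R M\<^esub> ?e \<one>\<^bsub>R\<^esub>"
      using r by (auto simp: free_cover_simps)
    also have "g \<dots> = r \<odot>\<^bsub>N\<^esub> g (?e \<one>\<^bsub>R\<^esub>)"
      using g r e[OF M.R.one_closed] by (auto simp: Hom_module_def)
    finally show False
      using nonsplit[of "g (?e \<one>\<^bsub>R\<^esub>)"] g e[OF M.R.one_closed] by (auto simp: Hom_module_def)
  qed
  let ?G = "(Hom_module R ?F1 N)\<lparr>carrier := Ext1_cocycles R M N\<rparr>"
  have "(\<lambda>w\<in>carrier ?F1. \<zero>\<^bsub>N\<^esub>) \<in> Ext1_coboundaries R M N"
  proof -
    have "(\<lambda>z\<in>carrier (free_cover R M). \<zero>\<^bsub>N\<^esub>) \<in> carrier (Hom_module R (free_cover R M) N)"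
      by (auto simp: Hom_module_def N.smult_zero M.free_cover_add_closed free_cover_simps
          M.free_cover_smult_closed)
    moreover have "compose (carrier ?F1) (\<lambda>z\<in>carrier (free_cover R M). \<zero>\<^bsub>N\<^esub>) (cover_map R ?S)
        = (\<lambda>w\<in>carrier ?F1. \<zero>\<^bsub>N\<^esub>)"
      using S.cover_map_closed SF by (auto simp: compose_def fun_eq_iff)
    ultimately show ?thesis
      unfolding Ext1_coboundaries_def by (metis (no_types, lifting) imageI)
  qed
  moreover have "(\<lambda>w\<in>carrier ?F1. \<zero>\<^bsub>N\<^esub>) \<otimes>\<^bsub>?G\<^esub> f = f"
    using f_hom by (auto simp: Hom_module_def fun_eq_iff PiE_def extensional_def Pi_def)
  ultimately have "f \<in> Ext1_coboundaries R M N #>\<^bsub>?G\<^esub> f"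
    unfolding r_coset_def by (metis (no_types, lifting) UN_iff singletonI)
  then have "Ext1_coboundaries R M N #>\<^bsub>?G\<^esub> f \<noteq> Ext1_coboundaries R M N"
    using f_not by blast
  moreover have "Ext1_coboundaries R M N #>\<^bsub>?G\<^esub> f \<in> carrier (Ext1 R M N)"
    using f_cocycle by (simp add: Ext1_def carrier_FactGroup)
  ultimately show ?thesis
    by (auto simp: Ext1_def)
qed

section \<open>Crossed maps on the free algebra\<close>

lemma type_algebra_simps:
  "carrier ring_of_type_algebra = UNIV"
  "x \<otimes>\<^bsub>ring_of_type_algebra\<^esub> y = x * y" "\<one>\<^bsub>ring_of_type_algebra\<^esub> = 1"
  "x \<oplus>\<^bsub>ring_of_type_algebra\<^esub> y = x + y" "\<zero>\<^bsub>ring_of_type_algebra\<^esub> = 0"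
  by (simp_all add: ring_of_type_algebra_def)

lemma ring_type_algebra: "ring (ring_of_type_algebra :: 'f::ring_1 ring)"
proof -
  have "\<exists>y. x + y = 0" for x :: 'f
    using add.right_inverse by blast
  then show ?thesis
    unfolding ring_of_type_algebra_def using add.right_inverse
    by unfold_locales (auto simp: algebra_simps Units_def)
qed

lemma (in abelian_group) add_interchange:
  "\<lbrakk>a \<in> carrier G; b \<in> carrier G; c \<in> carrier G; d \<in> carrier G\<rbrakk> \<Longrightarrow>
    (a \<oplus> b) \<oplus> (c \<oplus> d) = (a \<oplus> c) \<oplus> (b \<oplus> d)"
  by (simp add: a_assoc a_lcomm)

text \<open>A left module over a ring that is given as a type.\<close>

locale action = M?: abelian_group M
  for M :: "('a, 'v) ring_scheme" (structure) +
  fixes act :: "'f::ring_1 \<Rightarrow> 'a \<Rightarrow> 'a" (infixr "\<cdot>" 75)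
  assumes act_closed: "v \<in> carrier M \<Longrightarrow> p \<cdot> v \<in> carrier M"
    and act_add_left: "v \<in> carrier M \<Longrightarrow> (p + q) \<cdot> v = p \<cdot> v \<oplus>\<^bsub>M\<^esub> q \<cdot> v"
    and act_add_right: "\<lbrakk>v \<in> carrier M; w \<in> carrier M\<rbrakk> \<Longrightarrow> p \<cdot> (v \<oplus>\<^bsub>M\<^esub> w) = p \<cdot> v \<oplus>\<^bsub>M\<^esub> p \<cdot> w"
    and act_mult: "v \<in> carrier M \<Longrightarrow> (p * q) \<cdot> v = p \<cdot> q \<cdot> v"
    and act_one: "v \<in> carrier M \<Longrightarrow> 1 \<cdot> v = v"
begin

lemma act_zero_left: "v \<in> carrier M \<Longrightarrow> 0 \<cdot> v = \<zero>\<^bsub>M\<^esub>"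
  using act_add_left[of v 0 0] by (simp add: act_closed M.add.l_cancel_one')

lemma act_zero_right: "p \<cdot> \<zero>\<^bsub>M\<^esub> = \<zero>\<^bsub>M\<^esub>"
  using act_add_right[of "\<zero>\<^bsub>M\<^esub>" "\<zero>\<^bsub>M\<^esub>" p] by (simp add: act_closed M.add.l_cancel_one')

lemma act_diff_left: 
  assumes "v \<in> carrier M"
  shows "(p - q) \<cdot> v = p \<cdot> v \<ominus>\<^bsub>M\<^esub> q \<cdot> v"
proof -
  have "p \<cdot> v = (p - q) \<cdot> v \<oplus>\<^bsub>M\<^esub> q \<cdot> v"
    using act_add_left[OF assms, of "p - q" q] by simp
  then show ?thesis
    using assms by (simp add: M.minus_eq M.a_assoc M.r_neg act_closed)
qed

lemma act_power_zero:
  assumes "v \<in> carrier M" and "p ^ k \<cdot> v = \<zero>\<^bsub>M\<^esub>" and "k \<le> m"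
  shows "p ^ m \<cdot> v = \<zero>\<^bsub>M\<^esub>"
proof -
  have "p ^ m = p ^ (m - k) * p ^ k" using assms(3) by (simp flip: power_add)
  then show ?thesis using assms(1,2) by (simp add: act_mult act_zero_right)
qed

end

text \<open>The monomial of a word.\<close>

definition free_word :: "gen list \<Rightarrow> word \<Rightarrow>\<^sub>0 'k::comm_ring_1" where
  "free_word w = Poly_Mapping.single (Word w) 1"

lemma free_word_Nil: "free_word [] = 1"
  by (simp add: free_word_def flip: zero_word_def)

lemma free_word_Cons: "free_word (u # w) = free_gen u * free_word w"
  by (simp add: free_word_def free_gen_def mult_single plus_word_def)

lemma free_word_append: "free_word (w @ w') = free_word w * free_word w'"
  by (simp add: free_word_def mult_single plus_word_def)

lemma single_eq_free_word: "Poly_Mapping.single w c = free_const c * free_word (letters w)"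
  by (simp add: free_const_def free_word_def mult_single zero_word_def plus_word_def)

lemma free_const_hom:
  "free_const 0 = 0" "free_const 1 = 1"
  "free_const (c + d) = free_const c + free_const d" 
  "free_const (c * d) = free_const c * free_const d"
  by (simp_all add: free_const_def single_add mult_single)

lemma free_algebra_induct [case_names single add]:
  assumes single: "\<And>w c. P (Poly_Mapping.single w c)"
    and add: "\<And>p q. \<lbrakk>P p; P q\<rbrakk> \<Longrightarrow> P (p + q)"
  shows "P (p :: 'w \<Rightarrow>\<^sub>0 'k::comm_monoid_add)"
proof (induction p rule: update_induct)
  case const
  show ?case using single[of undefined 0] by simp
next
  case (update f w c)
  have "Poly_Mapping.update w c f = f + Poly_Mapping.single w c"
    using update(1) by (intro poly_mapping_eqI)
      (auto simp: lookup_update lookup_add lookup_single when_def in_keys_iff)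
  then show ?case using add[OF update(3) single] by simp
qed

lemma free_const_commute: "free_const c * p = p * free_const c"
  by (induction p rule: free_algebra_induct)
    (simp_all add: free_const_def mult_single mult.commute distrib_left distrib_right)

text \<open>A crossed map on the free algebra is determined by its values \<open>\<delta> u\<close> at the generators, which may
  be arbitrary \<open>K\<close>-linear maps from \<open>M\<close> to \<open>N\<close>.\<close>

locale free_crossed = M: action M actM + N: action N actN
  for M :: "('a, 'v) ring_scheme" and actM :: "(word \<Rightarrow>\<^sub>0 'k::comm_ring_1) \<Rightarrow> 'a \<Rightarrow> 'a" (infixr "\<cdot>\<^sub>M" 75)
    and N :: "('b, 'w) ring_scheme" and actN :: "(word \<Rightarrow>\<^sub>0 'k) \<Rightarrow> 'b \<Rightarrow> 'b" (infixr "\<cdot>\<^sub>N" 75) +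
  fixes \<delta> :: "gen \<Rightarrow> 'a \<Rightarrow> 'b"
  assumes \<delta>_closed: "v \<in> carrier M \<Longrightarrow> \<delta> u v \<in> carrier N"
    and \<delta>_add: "\<lbrakk>v \<in> carrier M; v' \<in> carrier M\<rbrakk> \<Longrightarrow> \<delta> u (v \<oplus>\<^bsub>M\<^esub> v') = \<delta> u v \<oplus>\<^bsub>N\<^esub> \<delta> u v'"
    and \<delta>_const: "v \<in> carrier M \<Longrightarrow> \<delta> u (free_const c \<cdot>\<^sub>M v) = free_const c \<cdot>\<^sub>N \<delta> u v"
begin

text \<open>The value at a word is forced by the Leibniz rule
  \<open>D(uw, v) = u D(w, v) + D(u, wv)\<close>.\<close>

primrec crossed_word :: "gen list \<Rightarrow> 'a \<Rightarrow> 'b" where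
  "crossed_word [] v = \<zero>\<^bsub>N\<^esub>"
| "crossed_word (u # w) v = free_gen u \<cdot>\<^sub>N crossed_word w v \<oplus>\<^bsub>N\<^esub> \<delta> u (free_word w \<cdot>\<^sub>M v)"

text \<open>The \<open>K\<close>-linear extension to the free algebra.\<close>

definition crossed :: "(word \<Rightarrow>\<^sub>0 'k) \<Rightarrow> 'a \<Rightarrow> 'b" where
  "crossed p v = (\<Oplus>\<^bsub>N\<^esub>w\<in>Poly_Mapping.keys p.
    free_const (Poly_Mapping.lookup p w) \<cdot>\<^sub>N crossed_word (letters w) v)"

lemma crossed_word_closed: "v \<in> carrier M \<Longrightarrow> crossed_word w v \<in> carrier N"
  by (induction w) (auto simp: N.act_closed M.act_closed \<delta>_closed)

lemma crossed_word_add: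
  "\<lbrakk>v \<in> carrier M; v' \<in> carrier M\<rbrakk> \<Longrightarrow>
    crossed_word w (v \<oplus>\<^bsub>M\<^esub> v') = crossed_word w v \<oplus>\<^bsub>N\<^esub> crossed_word w v'"
  by (induction w) (simp_all add: N.act_closed M.act_closed \<delta>_closed crossed_word_closed
    N.act_add_right M.act_add_right \<delta>_add N.M.a_ac)

lemma crossed_word_const:
  "v \<in> carrier M \<Longrightarrow> crossed_word w (free_const c \<cdot>\<^sub>M v) = free_const c \<cdot>\<^sub>N crossed_word w v"
proof (induction w)
  case (Cons u w)
  then show ?case
    by (simp add: N.act_closed M.act_closed \<delta>_closed crossed_word_closed N.act_add_right
        free_const_commute[symmetric] \<delta>_const flip: N.act_mult M.act_mult)
      (simp add: N.act_closed M.act_closed \<delta>_const M.act_mult)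
qed (simp add: N.act_zero_right)

lemma crossed_word_append:
  "v \<in> carrier M \<Longrightarrow> crossed_word (w @ w') v =
    free_word w \<cdot>\<^sub>N crossed_word w' v \<oplus>\<^bsub>N\<^esub> crossed_word w (free_word w' \<cdot>\<^sub>M v)"
  by (induction w) (simp_all add: N.act_closed M.act_closed \<delta>_closed crossed_word_closed
    N.act_add_right free_word_append free_word_Cons free_word_Nil N.act_mult M.act_mult N.act_one N.M.a_assoc)

lemma crossed_superset:
  assumes "v \<in> carrier M" and "finite S" and "Poly_Mapping.keys p \<subseteq> S"
  shows "crossed p v = (\<Oplus>\<^bsub>N\<^esub>w\<in>S. free_const (Poly_Mapping.lookup p w) \<cdot>\<^sub>N crossed_word (letters w) v)"
  unfolding crossed_def using assms
  by (intro N.M.finsum_eq_superset)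
    (auto simp: N.act_closed crossed_word_closed in_keys_iff free_const_hom N.act_zero_left)

lemma crossed_closed: "v \<in> carrier M \<Longrightarrow> crossed p v \<in> carrier N"
  unfolding crossed_def by (intro N.M.finsum_closed) (auto simp: N.act_closed crossed_word_closed)

lemma crossed_single:
  "v \<in> carrier M \<Longrightarrow> crossed (Poly_Mapping.single w c) v = free_const c \<cdot>\<^sub>N crossed_word (letters w) v"
  by (subst crossed_superset[of _ "{w}"])
    (auto simp: N.M.finsum_insert N.act_closed crossed_word_closed)

lemma crossed_add_left:
  assumes v: "v \<in> carrier M"
  shows "crossed (p + q) v = crossed p v \<oplus>\<^bsub>N\<^esub> crossed q v"
proof -
  let ?S = "Poly_Mapping.keys p \<union> Poly_Mapping.keys q"
  have "crossed (p + q) v = (\<Oplus>\<^bsub>N\<^esub>w\<in>?S. free_const (Poly_Mapping.lookup p w) \<cdot>\<^sub>N crossed_word (letters w) v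
     \<oplus>\<^bsub>N\<^esub> free_const (Poly_Mapping.lookup q w) \<cdot>\<^sub>N crossed_word (letters w) v)"
    using v by (subst crossed_superset[of _ ?S])
      (auto simp: keys_add lookup_add free_const_hom N.act_add_left crossed_word_closed)
  also have "\<dots> = crossed p v \<oplus>\<^bsub>N\<^esub> crossed q v"
    using v by (subst N.M.finsum_addf)
      (auto simp: N.act_closed crossed_word_closed crossed_superset[of _ ?S])
  finally show ?thesis .
qed

lemma crossed_add_right:
  "\<lbrakk>v \<in> carrier M; v' \<in> carrier M\<rbrakk> \<Longrightarrow> crossed p (v \<oplus>\<^bsub>M\<^esub> v') = crossed p v \<oplus>\<^bsub>N\<^esub> crossed p v'"
proof (induction p rule: free_algebra_induct)
  case (single w c)
  then show ?case by (simp add: crossed_single crossed_word_add N.act_add_right crossed_word_closed)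
next
  case (add p q)
  then show ?case by (simp add: crossed_add_left crossed_closed N.M.add_interchange)
qed

lemma crossed_mult:
  "v \<in> carrier M \<Longrightarrow> crossed (p * q) v = p \<cdot>\<^sub>N crossed q v \<oplus>\<^bsub>N\<^esub> crossed p (q \<cdot>\<^sub>M v)"
proof (induction p rule: free_algebra_induct)
  case (single w c)
  then show ?case
  proof (induction q rule: free_algebra_induct)
    case (single w' d)
    let ?w = "free_word (letters w) :: word \<Rightarrow>\<^sub>0 'k" and ?c = "free_const c" and ?d = "free_const d"
    have "crossed (Poly_Mapping.single w c * Poly_Mapping.single w' d) v
        = (?c * ?d) \<cdot>\<^sub>N (?w \<cdot>\<^sub>N crossed_word (letters w') v
            \<oplus>\<^bsub>N\<^esub> crossed_word (letters w) (free_word (letters w') \<cdot>\<^sub>M v))"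
      using single by (simp add: mult_single crossed_single plus_word_def crossed_word_append free_const_hom)
    also have "\<dots> = (?c * ?d * ?w) \<cdot>\<^sub>N crossed_word (letters w') v
        \<oplus>\<^bsub>N\<^esub> (?c * ?d) \<cdot>\<^sub>N crossed_word (letters w) (free_word (letters w') \<cdot>\<^sub>M v)"
      using single by (simp add: N.act_add_right N.act_mult N.act_closed M.act_closed crossed_word_closed)
    also have "?c * ?d * ?w = ?c * ?w * ?d"
      by (metis free_const_commute mult.assoc)
    also have "\<dots> \<cdot>\<^sub>N crossed_word (letters w') v
        = Poly_Mapping.single w c \<cdot>\<^sub>N crossed (Poly_Mapping.single w' d) v"
      using single by (simp add: crossed_single single_eq_free_word[of w] N.act_mult crossed_word_closed N.act_closed)
    also have "(?c * ?d) \<cdot>\<^sub>N crossed_word (letters w) (free_word (letters w') \<cdot>\<^sub>M v)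
        = crossed (Poly_Mapping.single w c) (Poly_Mapping.single w' d \<cdot>\<^sub>M v)"
      using single
      by (simp add: crossed_single single_eq_free_word[of w'] N.act_mult M.act_mult crossed_word_const
        crossed_word_closed N.act_closed M.act_closed)
    finally show ?case .
  next
    case (add q q')
    then show ?case
      by (simp add: distrib_left crossed_add_left crossed_add_right crossed_closed N.act_add_right
        M.act_add_left N.act_closed M.act_closed N.M.add_interchange)
  qed
next
  case (add p p')
  then show ?case
    by (simp add: distrib_right crossed_add_left crossed_closed N.act_add_left N.act_closed
        M.act_closed N.M.add_interchange)
qed

lemma crossed_const: "v \<in> carrier M \<Longrightarrow> crossed (free_const c) v = \<zero>\<^bsub>N\<^esub>"
  by (simp add: free_const_def crossed_single N.act_zero_right zero_word_def)

lemma crossed_gen: "v \<in> carrier M \<Longrightarrow> crossed (free_gen u) v = \<delta> u v"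
  by (simp add: free_gen_def crossed_single N.act_zero_right M.act_one N.act_one \<delta>_closed free_word_Nil
    free_const_hom)

lemma crossed_zero_left: "v \<in> carrier M \<Longrightarrow> crossed 0 v = \<zero>\<^bsub>N\<^esub>"
  using crossed_const[of v 0] by (simp add: free_const_hom)

lemma crossed_zero_right: "crossed p \<zero>\<^bsub>M\<^esub> = \<zero>\<^bsub>N\<^esub>"
  using crossed_add_right[of "\<zero>\<^bsub>M\<^esub>" "\<zero>\<^bsub>M\<^esub>" p] crossed_closed[of "\<zero>\<^bsub>M\<^esub>" p] 
  by (simp add: N.M.add.l_cancel_one')

lemma crossed_diff_left:
  assumes "v \<in> carrier M"
  shows "crossed (p - q) v = crossed p v \<ominus>\<^bsub>N\<^esub> crossed q v"
proof -
  have "crossed p v = crossed (p - q) v \<oplus>\<^bsub>N\<^esub> crossed q v"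
    using crossed_add_left[OF assms, of "p - q" q] by simp
  then show ?thesis
    using assms by (simp add: N.M.minus_eq N.M.a_assoc N.M.r_neg crossed_closed)
qed

end

section \<open>Crossed maps on a quotient of the free algebra\<close>

text \<open>The action of the ring \<open>F\<close> on a module over \<open>F/I\<close>.\<close>

abbreviation quotient_act ::
  "'f::ring_1 set \<Rightarrow> ('f set, 'a, 'v) module_scheme \<Rightarrow> 'f \<Rightarrow> 'a \<Rightarrow> 'a" where
  "quotient_act I M p v \<equiv> (I +>\<^bsub>ring_of_type_algebra\<^esub> p) \<odot>\<^bsub>M\<^esub> v"

lemma ideal_type_algebraI:
  fixes J :: "'f::ring_1 set"
  assumes "0 \<in> J" and add: "\<And>p q. \<lbrakk>p \<in> J; q \<in> J\<rbrakk> \<Longrightarrow> p + q \<in> J"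
    and left: "\<And>p s. p \<in> J \<Longrightarrow> s * p \<in> J" and right: "\<And>p s. p \<in> J \<Longrightarrow> p * s \<in> J"
  shows "ideal J ring_of_type_algebra"
proof -
  interpret ring "ring_of_type_algebra :: 'f ring" by (rule ring_type_algebra)
  have minus: "\<ominus>\<^bsub>ring_of_type_algebra\<^esub> p = - p" for p :: 'f
    by (rule minus_equality) (simp_all add: type_algebra_simps)
  have "- p \<in> J" if "p \<in> J" for p using left[OF that, of "- 1"] by simp
  then have "subgroup J (add_monoid ring_of_type_algebra)"
    using assms(1) add minus
    by (intro add.subgroupI) (auto simp: type_algebra_simps simp flip: a_inv_def)
  then show ?thesis
    by (intro idealI ring_type_algebra) (simp_all add: type_algebra_simps left right)
qed

lemma quotient_coset_hom:
  fixes I :: "'f::ring_1 set"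
  assumes "ideal I ring_of_type_algebra"
  defines "R \<equiv> ring_of_type_algebra Quot I"
  shows "I +>\<^bsub>ring_of_type_algebra\<^esub> p \<in> carrier R"
    and "I +>\<^bsub>ring_of_type_algebra\<^esub> (p * q) =
      (I +>\<^bsub>ring_of_type_algebra\<^esub> p) \<otimes>\<^bsub>R\<^esub> (I +>\<^bsub>ring_of_type_algebra\<^esub> q)"
    and "I +>\<^bsub>ring_of_type_algebra\<^esub> (p + q) =
      (I +>\<^bsub>ring_of_type_algebra\<^esub> p) \<oplus>\<^bsub>R\<^esub> (I +>\<^bsub>ring_of_type_algebra\<^esub> q)"
    and "I +>\<^bsub>ring_of_type_algebra\<^esub> 1 = \<one>\<^bsub>R\<^esub>"
    and "p \<in> I \<Longrightarrow> I +>\<^bsub>ring_of_type_algebra\<^esub> p = \<zero>\<^bsub>R\<^esub>"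
proof -
  interpret ideal I ring_of_type_algebra by fact
  interpret h: ring_hom_ring ring_of_type_algebra R "(+>\<^bsub>ring_of_type_algebra\<^esub>) I"
    unfolding R_def by (rule rcos_ring_hom_ring)
  show "I +>\<^bsub>ring_of_type_algebra\<^esub> p \<in> carrier R"
    using h.hom_closed[of p] by (simp add: type_algebra_simps)
  show "I +>\<^bsub>ring_of_type_algebra\<^esub> (p * q) =
      (I +>\<^bsub>ring_of_type_algebra\<^esub> p) \<otimes>\<^bsub>R\<^esub> (I +>\<^bsub>ring_of_type_algebra\<^esub> q)"
    using h.hom_mult[of p q] by (simp add: type_algebra_simps)
  show "I +>\<^bsub>ring_of_type_algebra\<^esub> (p + q) =
      (I +>\<^bsub>ring_of_type_algebra\<^esub> p) \<oplus>\<^bsub>R\<^esub> (I +>\<^bsub>ring_of_type_algebra\<^esub> q)"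
    using h.hom_add[of p q] by (simp add: type_algebra_simps)
  show "I +>\<^bsub>ring_of_type_algebra\<^esub> 1 = \<one>\<^bsub>R\<^esub>"
    using h.hom_one by (simp add: type_algebra_simps)
  have "\<zero>\<^bsub>R\<^esub> = I" unfolding R_def FactRing_def by simp
  then show "I +>\<^bsub>ring_of_type_algebra\<^esub> p = \<zero>\<^bsub>R\<^esub>" if "p \<in> I"
    using a_rcos_const[OF that] by (rule trans[OF _ sym, rotated])
qed

lemma quotient_action:
  assumes I: "ideal I ring_of_type_algebra" and "left_module (ring_of_type_algebra Quot I) M"
  shows "action M (quotient_act I M)"
proof -
  interpret left_module "ring_of_type_algebra Quot I" M by fact
  show ?thesis
    by unfold_locales (simp_all add: quotient_coset_hom[OF I] smult_closed smult_l_distr smult_r_distr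
      smult_assoc smult_one)
qed

lemma quotient_act_ideal:
  assumes I: "ideal I ring_of_type_algebra" and "left_module (ring_of_type_algebra Quot I) M"
    and "p \<in> I" and "v \<in> carrier M"
  shows "quotient_act I M p v = \<zero>\<^bsub>M\<^esub>"
  using assms(3,4) by (simp add: quotient_coset_hom[OF I] left_module.zero_smult[OF assms(2)])

lemma ideal_type_algebra_Idl: "ideal (Idl\<^bsub>ring_of_type_algebra\<^esub> S) (ring_of_type_algebra :: 'f::ring_1 ring)"
  by (intro ring.genideal_ideal ring_type_algebra) (simp add: type_algebra_simps)

text \<open>A crossed map on the free algebra descends to the quotient by the ideal \<open>I\<close> as soon as it
  vanishes on generators of \<open>I\<close>: since \<open>I\<close> annihilates \<open>M\<close> and \<open>N\<close>, the Leibniz rule shows that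
  the elements of \<open>I\<close> at which it vanishes form an ideal.\<close>

theorem Ext1_nontrivial_of_free_crossed:
  fixes S :: "(word \<Rightarrow>\<^sub>0 'k::comm_ring_1) set"
  defines "I \<equiv> Idl\<^bsub>free_algebra\<^esub> S" 
  assumes modules: "left_module (free_algebra Quot I) M" "left_module (free_algebra Quot I) N"
    and "free_crossed M (quotient_act I M) N (quotient_act I N) \<delta>"
    and relators: "\<And>s v. \<lbrakk>s \<in> S; v \<in> carrier M\<rbrakk> \<Longrightarrow>
      free_crossed.crossed (quotient_act I M) N (quotient_act I N) \<delta> s v = \<zero>\<^bsub>N\<^esub>"
    and v: "v \<in> carrier M" and pv: "quotient_act I M p v = \<zero>\<^bsub>M\<^esub>"
    and nonsplit: "\<And>w. w \<in> carrier N \<Longrightarrow>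
      free_crossed.crossed (quotient_act I M) N (quotient_act I N) \<delta> p v \<noteq> quotient_act I N p w"
  shows "carrier (Ext1 (free_algebra Quot I) M N) \<noteq> {\<one>\<^bsub>Ext1 (free_algebra Quot I) M N\<^esub>}"
proof -
  have I: "ideal I free_algebra" unfolding I_def by (rule ideal_type_algebra_Idl)
  interpret I: ideal I free_algebra by (rule I)
  interpret LM: left_module "free_algebra Quot I" M by (rule modules(1))
  interpret LN: left_module "free_algebra Quot I" N by (rule modules(2))
  interpret free_crossed M "quotient_act I M" N "quotient_act I N" \<delta> by fact
  let ?cl = "\<lambda>p. I +>\<^bsub>free_algebra\<^esub> p"
  note hom = quotient_coset_hom[OF I]
  have vanish: "crossed j v = \<zero>\<^bsub>N\<^esub>" if j: "j \<in> I" and v: "v \<in> carrier M" for j v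
  proof -
    let ?J = "{j \<in> I. \<forall>v\<in>carrier M. crossed j v = \<zero>\<^bsub>N\<^esub>}"
    have closed: "p \<in> ?J \<Longrightarrow> s * p \<in> ?J" "p \<in> ?J \<Longrightarrow> p * s \<in> ?J" for p s
      using I.I_l_closed[of p s] I.I_r_closed[of p s] quotient_act_ideal[OF I modules(1)]
      by (auto simp: crossed_mult M.act_closed N.act_closed N.act_zero_right crossed_zero_right
          quotient_act_ideal[OF I modules(2)] crossed_closed type_algebra_simps)
    have "ideal ?J free_algebra"
    proof (rule ideal_type_algebraI)
      show "0 \<in> ?J"
        using additive_subgroup.zero_closed[OF ideal.axioms(1)[OF I]]
        by (simp add: crossed_zero_left type_algebra_simps)
      show "p + q \<in> ?J" if "p \<in> ?J" "q \<in> ?J" for p q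
        using that additive_subgroup.a_closed[OF ideal.axioms(1)[OF I], of p q]
        by (auto simp: crossed_add_left type_algebra_simps)
    qed (fact closed)+
    moreover have "S \<subseteq> ?J"
      using relators I.genideal_self[of S] by (auto simp: I_def type_algebra_simps)
    ultimately have "I \<subseteq> ?J"
      unfolding I_def using I.genideal_minimal by blast
    then show ?thesis using j v by auto
  qed
  define D where "D r v = crossed (SOME p. ?cl p = r) v" for r v
  have D: "D (?cl p) v = crossed p v" if v: "v \<in> carrier M" for p v
  proof -
    define p' where "p' = (SOME p'. ?cl p' = ?cl p)"
    have "?cl p' = ?cl p" unfolding p'_def by (rule someI[of _ p]) simp
    then have "p' \<in> ?cl p"
      using I.a_rcos_self[of p'] by (simp add: type_algebra_simps)
    then obtain j where j: "j \<in> I" "p' = j + p"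
      by (auto simp: a_r_coset_def' type_algebra_simps)
    then show ?thesis
      using v by (simp add: D_def p'_def[symmetric] crossed_add_left vanish crossed_closed)
  qed
  have rep: "\<exists>p. r = ?cl p" if "r \<in> carrier (free_algebra Quot I)" for r
    using that by (auto simp: FactRing_def A_RCOSETS_def')
  have biadd: "biadditive (free_algebra Quot I) M N D"
  proof unfold_locales
    fix r v assume "r \<in> carrier (free_algebra Quot I)" "v \<in> carrier M"
    then show "D r v \<in> carrier N" using rep[of r] by (auto simp: D crossed_closed)
  next
    fix r s v assume "r \<in> carrier (free_algebra Quot I)" "s \<in> carrier (free_algebra Quot I)" "v \<in> carrier M"
    then show "D (r \<oplus>\<^bsub>free_algebra Quot I\<^esub> s) v = D r v \<oplus>\<^bsub>N\<^esub> D s v"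
      using rep[of r] rep[of s] by (auto simp: D crossed_add_left simp flip: hom(3))
  next
    fix r v w assume "r \<in> carrier (free_algebra Quot I)" "v \<in> carrier M" "w \<in> carrier M"
    then show "D r (v \<oplus>\<^bsub>M\<^esub> w) = D r v \<oplus>\<^bsub>N\<^esub> D r w"
      using rep[of r] by (auto simp: D crossed_add_right)
  qed
  have leibniz: "D (r \<otimes>\<^bsub>free_algebra Quot I\<^esub> s) v = r \<odot>\<^bsub>N\<^esub> D s v \<oplus>\<^bsub>N\<^esub> D r (s \<odot>\<^bsub>M\<^esub> v)"
    if "r \<in> carrier (free_algebra Quot I)" "s \<in> carrier (free_algebra Quot I)" "v \<in> carrier M" for r s v
    using rep[of r] rep[of s] that M.act_closed[of v]
    by (auto simp: D crossed_mult simp flip: hom(2))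
  show ?thesis
    using nonsplit v pv
    by (intro Ext1_nontrivial_of_crossed_map[OF modules biadd leibniz, where r = "?cl p" and x = v])
      (auto simp: D hom(1))
qed

section \<open>Modules with a basis of scalars\<close>

text \<open>A module over the free algebra for which \<open>m 0, \<dots>, m (t - 1)\<close> is a \<open>K\<close>-basis. Uniqueness of
  coefficients is meant for functions on \<open>{..<t}\<close>, which are extensional.\<close>

locale based_action = action M act
  for M :: "('a, 'v) ring_scheme" and act :: "(word \<Rightarrow>\<^sub>0 'k::comm_ring_1) \<Rightarrow> 'a \<Rightarrow> 'a" (infixr "\<cdot>" 75) +
  fixes t :: nat and m :: "nat \<Rightarrow> 'a"
  assumes basis_closed: "j < t \<Longrightarrow> m j \<in> carrier M"
    and basis: "v \<in> carrier M \<Longrightarrow>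
      \<exists>!\<kappa>. \<kappa> \<in> {..<t} \<rightarrow>\<^sub>E UNIV \<and> v = (\<Oplus>\<^bsub>M\<^esub>j\<in>{..<t}. free_const (\<kappa> j) \<cdot> m j)"
begin

text \<open>\<open>coord v j\<close> is the \<open>j\<close>-th coordinate of \<open>v\<close>; it is meaningful for \<open>j < t\<close> only.\<close>

definition coord :: "'a \<Rightarrow> nat \<Rightarrow> 'k" where
  "coord v = (THE \<kappa>. \<kappa> \<in> {..<t} \<rightarrow>\<^sub>E UNIV \<and> v = (\<Oplus>\<^bsub>M\<^esub>j\<in>{..<t}. free_const (\<kappa> j) \<cdot> m j))"

lemma coord_expansion:
  assumes "v \<in> carrier M"
  shows "v = (\<Oplus>\<^bsub>M\<^esub>j\<in>{..<t}. free_const (coord v j) \<cdot> m j)"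
  using theI'[OF basis[OF assms]] by (simp add: coord_def)

lemma coord_eqI:
  assumes "v = (\<Oplus>\<^bsub>M\<^esub>j\<in>{..<t}. free_const (\<kappa> j) \<cdot> m j)" and "j < t"
  shows "coord v j = \<kappa> j"
proof -
  have v: "v \<in> carrier M"
    unfolding assms(1) by (intro M.finsum_closed) (auto simp: act_closed basis_closed)
  have "(\<Oplus>\<^bsub>M\<^esub>j\<in>{..<t}. free_const (restrict \<kappa> {..<t} j) \<cdot> m j)
      = (\<Oplus>\<^bsub>M\<^esub>j\<in>{..<t}. free_const (\<kappa> j) \<cdot> m j)"
    by (intro M.finsum_cong) (auto simp: act_closed basis_closed simp_implies_def)
  then have "coord v = restrict \<kappa> {..<t}"
    unfolding coord_def using assms(1) by (intro the1_equality[OF basis[OF v]]) auto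
  then show ?thesis using assms(2) by simp
qed

lemma coord_add:
  assumes "v \<in> carrier M" and "w \<in> carrier M" and "j < t"
  shows "coord (v \<oplus>\<^bsub>M\<^esub> w) j = coord v j + coord w j"
proof (rule coord_eqI[OF _ assms(3)])
  have "v \<oplus>\<^bsub>M\<^esub> w = (\<Oplus>\<^bsub>M\<^esub>j\<in>{..<t}. free_const (coord v j) \<cdot> m j) \<oplus>\<^bsub>M\<^esub>
      (\<Oplus>\<^bsub>M\<^esub>j\<in>{..<t}. free_const (coord w j) \<cdot> m j)"
    using coord_expansion[OF assms(1)] coord_expansion[OF assms(2)] by simp
  also have "\<dots> = (\<Oplus>\<^bsub>M\<^esub>j\<in>{..<t}. free_const (coord v j) \<cdot> m j \<oplus>\<^bsub>M\<^esub> free_const (coord w j) \<cdot> m j)"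
    by (intro M.finsum_addf[symmetric]) (auto simp: act_closed basis_closed)
  also have "\<dots> = (\<Oplus>\<^bsub>M\<^esub>j\<in>{..<t}. free_const (coord v j + coord w j) \<cdot> m j)"
    by (intro M.finsum_cong)
      (auto simp: act_closed basis_closed free_const_hom act_add_left simp_implies_def)
  finally show "v \<oplus>\<^bsub>M\<^esub> w = (\<Oplus>\<^bsub>M\<^esub>j\<in>{..<t}. free_const (coord v j + coord w j) \<cdot> m j)" .
qed

lemma act_finsum:
  assumes "finite S" and "f \<in> S \<rightarrow> carrier M"
  shows "p \<cdot> (\<Oplus>\<^bsub>M\<^esub>s\<in>S. f s) = (\<Oplus>\<^bsub>M\<^esub>s\<in>S. p \<cdot> f s)"
  using assms by (intro additive_finsum[OF M.abelian_group_axioms M.abelian_group_axioms])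
    (auto simp: act_closed act_add_right)

lemma coord_const:
  assumes "v \<in> carrier M" and "j < t"
  shows "coord (free_const c \<cdot> v) j = c * coord v j"
proof (rule coord_eqI[OF _ assms(2)])
  have "free_const c \<cdot> v = free_const c \<cdot> (\<Oplus>\<^bsub>M\<^esub>j\<in>{..<t}. free_const (coord v j) \<cdot> m j)"
    using coord_expansion[OF assms(1)] by simp
  also have "\<dots> = (\<Oplus>\<^bsub>M\<^esub>j\<in>{..<t}. free_const c \<cdot> free_const (coord v j) \<cdot> m j)"
    by (intro act_finsum) (auto simp: act_closed basis_closed)
  also have "\<dots> = (\<Oplus>\<^bsub>M\<^esub>j\<in>{..<t}. free_const (c * coord v j) \<cdot> m j)"
    by (intro M.finsum_cong)
      (auto simp: act_closed basis_closed free_const_hom act_mult simp_implies_def)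
  finally show "free_const c \<cdot> v = (\<Oplus>\<^bsub>M\<^esub>j\<in>{..<t}. free_const (c * coord v j) \<cdot> m j)" .
qed

lemma coord_basis:
  assumes "k < t" and "j < t"
  shows "coord (m k) j = (if j = k then 1 else 0)"
proof (rule coord_eqI[OF _ assms(2)])
  have "(\<Oplus>\<^bsub>M\<^esub>j\<in>{..<t}. free_const (if j = k then 1 else 0) \<cdot> m j) = free_const (if k = k then 1 else 0) \<cdot> m k"
    using assms(1) by (intro M.finsum_single_term)
      (auto simp: free_const_hom act_zero_left basis_closed act_closed)
  then show "m k = (\<Oplus>\<^bsub>M\<^esub>j\<in>{..<t}. free_const (if j = k then 1 else 0) \<cdot> m j)"
    using assms(1) by (simp add: free_const_hom act_one basis_closed)
qed

lemma coord_zero: "j < t \<Longrightarrow> coord \<zero>\<^bsub>M\<^esub> j = 0"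
  using coord_const[of "\<zero>\<^bsub>M\<^esub>" j 0] by (simp add: act_zero_right)

lemma basis_induct [consumes 1, case_names zero basis add const]:
  assumes "v \<in> carrier M"
    and "P \<zero>\<^bsub>M\<^esub>" and "\<And>j. j < t \<Longrightarrow> P (m j)"
    and add: "\<And>v w. \<lbrakk>v \<in> carrier M; w \<in> carrier M; P v; P w\<rbrakk> \<Longrightarrow> P (v \<oplus>\<^bsub>M\<^esub> w)"
    and const: "\<And>c v. \<lbrakk>v \<in> carrier M; P v\<rbrakk> \<Longrightarrow> P (free_const c \<cdot> v)"
  shows "P v"
proof -
  have "P (\<Oplus>\<^bsub>M\<^esub>j\<in>S. free_const (c j) \<cdot> m j)" if "finite S" "S \<subseteq> {..<t}" for S c
    using that
  proof (induction S rule: finite_induct)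
    case empty
    then show ?case using assms(2) by simp
  next
    case (insert j S)
    have cl: "(\<lambda>j. free_const (c j) \<cdot> m j) \<in> S \<rightarrow> carrier M" "m j \<in> carrier M"
      using insert.prems by (auto simp: act_closed basis_closed)
    have "P (free_const (c j) \<cdot> m j \<oplus>\<^bsub>M\<^esub> (\<Oplus>\<^bsub>M\<^esub>j\<in>S. free_const (c j) \<cdot> m j))"
      using insert cl by (intro add const M.finsum_closed assms(3)) (auto simp: act_closed)
    then show ?case
      using insert.hyps cl by (simp add: M.finsum_insert act_closed)
  qed
  from this[of "{..<t}" "coord v"] show ?thesis
    using coord_expansion[OF assms(1)] by simp
qed

lemma act_const_commute:
  "v \<in> carrier M \<Longrightarrow> p \<cdot> free_const c \<cdot> v = free_const c \<cdot> p \<cdot> v"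
  by (metis act_mult free_const_commute)

lemma act_zero_of_basis:
  assumes "\<And>j. j < t \<Longrightarrow> p \<cdot> m j = \<zero>\<^bsub>M\<^esub>" and "v \<in> carrier M"
  shows "p \<cdot> v = \<zero>\<^bsub>M\<^esub>"
  using assms(2) by (induction rule: basis_induct)
    (simp_all add: assms(1) act_zero_right act_add_right act_const_commute)

end

locale based_pair = M: based_action M actM t m + N: based_action N actN t m'
  for M :: "('a, 'v) ring_scheme" and actM :: "(word \<Rightarrow>\<^sub>0 'k::comm_ring_1) \<Rightarrow> 'a \<Rightarrow> 'a" (infixr "\<cdot>\<^sub>M" 75)
    and N :: "('b, 'w) ring_scheme" and actN :: "(word \<Rightarrow>\<^sub>0 'k) \<Rightarrow> 'b \<Rightarrow> 'b" (infixr "\<cdot>\<^sub>N" 75)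
    and t :: nat and m :: "nat \<Rightarrow> 'a" and m' :: "nat \<Rightarrow> 'b"
begin

text \<open>The \<open>K\<close>-linear map that matches the two bases.\<close>

definition \<phi> :: "'a \<Rightarrow> 'b" where
  "\<phi> v = (\<Oplus>\<^bsub>N\<^esub>j\<in>{..<t}. free_const (M.coord v j) \<cdot>\<^sub>N m' j)"

lemma \<phi>_closed: "\<phi> v \<in> carrier N"
  unfolding \<phi>_def by (intro N.M.finsum_closed) (auto simp: N.act_closed N.basis_closed)

lemma \<phi>_add: "\<lbrakk>v \<in> carrier M; w \<in> carrier M\<rbrakk> \<Longrightarrow> \<phi> (v \<oplus>\<^bsub>M\<^esub> w) = \<phi> v \<oplus>\<^bsub>N\<^esub> \<phi> w"
proof -
  assume vw: "v \<in> carrier M" "w \<in> carrier M"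
  have "\<phi> (v \<oplus>\<^bsub>M\<^esub> w) = (\<Oplus>\<^bsub>N\<^esub>j\<in>{..<t}. free_const (M.coord v j) \<cdot>\<^sub>N m' j \<oplus>\<^bsub>N\<^esub> free_const (M.coord w j) \<cdot>\<^sub>N m' j)"
    unfolding \<phi>_def by (intro N.M.finsum_cong) (auto simp: vw M.coord_add free_const_hom
      N.act_add_left N.basis_closed N.act_closed simp_implies_def)
  also have "\<dots> = \<phi> v \<oplus>\<^bsub>N\<^esub> \<phi> w"
    unfolding \<phi>_def by (intro N.M.finsum_addf) (auto simp: N.act_closed N.basis_closed)
  finally show ?thesis .
qed

lemma \<phi>_const: "v \<in> carrier M \<Longrightarrow> \<phi> (free_const c \<cdot>\<^sub>M v) = free_const c \<cdot>\<^sub>N \<phi> v"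
proof -
  assume v: "v \<in> carrier M"
  have "\<phi> (free_const c \<cdot>\<^sub>M v) = (\<Oplus>\<^bsub>N\<^esub>j\<in>{..<t}. free_const c \<cdot>\<^sub>N free_const (M.coord v j) \<cdot>\<^sub>N m' j)"
    unfolding \<phi>_def by (intro N.M.finsum_cong) (auto simp: v M.coord_const free_const_hom
      N.act_mult N.basis_closed N.act_closed simp_implies_def)
  also have "\<dots> = free_const c \<cdot>\<^sub>N \<phi> v"
    unfolding \<phi>_def by (intro N.act_finsum[symmetric]) (auto simp: N.act_closed N.basis_closed)
  finally show ?thesis .
qed

lemma \<phi>_basis: "k < t \<Longrightarrow> \<phi> (m k) = m' k"
proof -
  assume k: "k < t"
  have "\<phi> (m k) = free_const (M.coord (m k) k) \<cdot>\<^sub>N m' k"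
    unfolding \<phi>_def using k by (intro N.M.finsum_single_term)
      (auto simp: M.coord_basis free_const_hom N.act_zero_left N.act_closed N.basis_closed)
  then show ?thesis
    using k by (simp add: M.coord_basis free_const_hom N.act_one N.basis_closed)
qed

lemma \<phi>_zero: "\<phi> \<zero>\<^bsub>M\<^esub> = \<zero>\<^bsub>N\<^esub>"
  using \<phi>_const[of "\<zero>\<^bsub>M\<^esub>" 0] by (simp add: M.act_zero_right free_const_hom N.act_zero_left \<phi>_closed)

lemma \<phi>_intertwines:
  assumes "\<And>j. j < t \<Longrightarrow> \<phi> (p \<cdot>\<^sub>M m j) = p' \<cdot>\<^sub>N m' j" and "v \<in> carrier M"
  shows "\<phi> (p \<cdot>\<^sub>M v) = p' \<cdot>\<^sub>N \<phi> v"
  using assms(2) by (induction rule: M.basis_induct)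
    (simp_all add: assms(1) \<phi>_zero \<phi>_basis M.act_zero_right N.act_zero_right M.act_add_right
      N.act_add_right \<phi>_add M.act_closed \<phi>_closed M.act_const_commute N.act_const_commute \<phi>_const)

end

section \<open>Structure of the modules \<open>V\<^sub>t(\<gamma>\<^sub>1, \<gamma>\<^sub>2, \<gamma>\<^sub>3; i)\<close>\<close>

text \<open>A module \<open>V\<^sub>t(\<gamma>\<^sub>1, \<gamma>\<^sub>2, \<gamma>\<^sub>3; i)\<close>, seen as a module over the free algebra that is
  annihilated by the relators of \<open>H\<^sub>\<beta>\<close>, together with its basis.\<close>

locale V_module = based_action M act t m
  for M :: "('a, 'v) ring_scheme" and act :: "(word \<Rightarrow>\<^sub>0 'k::field) \<Rightarrow> 'a \<Rightarrow> 'a" (infixr "\<cdot>" 75)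
    and t :: nat and m :: "nat \<Rightarrow> 'a" +
  fixes n n1 :: nat and q \<beta>1 \<beta>2 \<beta>3 g \<gamma>2 \<gamma>3 :: 'k and i :: int
  assumes t_pos: "0 < t"
    and relator: "\<lbrakk>r \<in> H_relators n n1 q \<beta>1 \<beta>2 \<beta>3; v \<in> carrier M\<rbrakk> \<Longrightarrow> r \<cdot> v = \<zero>\<^bsub>M\<^esub>"
    and a_basis: "j < t \<Longrightarrow> free_gen Gen_a \<cdot> m j = free_const (g * q powi (i - int j)) \<cdot> m j"
    and b_basis: "j < t \<Longrightarrow> free_gen Gen_b \<cdot> m j = free_const \<gamma>2 \<cdot> m j"
    and c_basis: "j < t \<Longrightarrow> free_gen Gen_c \<cdot> m j = free_const \<gamma>3 \<cdot> m j"
    and x_basis: "j < t - 1 \<Longrightarrow> free_gen Gen_x \<cdot> m j = m (j + 1)"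
    and x_last: "free_gen Gen_x \<cdot> m (t - 1) = \<zero>\<^bsub>M\<^esub>"
    and y_first: "free_gen Gen_y \<cdot> m 0 = \<zero>\<^bsub>M\<^esub>"
    and y_basis: "\<lbrakk>1 \<le> l; l \<le> t - 1\<rbrakk> \<Longrightarrow>
      free_gen Gen_y \<cdot> m l = free_const (V_coeff n1 q \<beta>3 g \<gamma>2 \<gamma>3 i l) \<cdot> m (l - 1)"
begin

lemma relation:
  assumes "p - p' \<in> H_relators n n1 q \<beta>1 \<beta>2 \<beta>3" and "v \<in> carrier M"
  shows "p \<cdot> v = p' \<cdot> v"
proof -
  have "p \<cdot> v = (p - p') \<cdot> v \<oplus>\<^bsub>M\<^esub> p' \<cdot> v"
    using act_add_left[OF assms(2), of "p - p'" p'] by simp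
  then show ?thesis using relator[OF assms] assms(2) by (simp add: act_closed)
qed

lemma x_a: "v \<in> carrier M \<Longrightarrow>
    free_gen Gen_x \<cdot> free_gen Gen_a \<cdot> v = free_const q \<cdot> free_gen Gen_a \<cdot> free_gen Gen_x \<cdot> v"
  using relation[of "free_gen Gen_x * free_gen Gen_a" "free_const q * (free_gen Gen_a * free_gen Gen_x)" v]
  by (simp add: H_relators_def Let_def act_mult act_closed)

lemma b_x: "v \<in> carrier M \<Longrightarrow> free_gen Gen_b \<cdot> free_gen Gen_x \<cdot> v = free_gen Gen_x \<cdot> free_gen Gen_b \<cdot> v"
  using relation[of "free_gen Gen_b * free_gen Gen_x" "free_gen Gen_x * free_gen Gen_b" v]
  by (simp add: H_relators_def Let_def act_mult act_closed)

lemma c_x: "v \<in> carrier M \<Longrightarrow> free_gen Gen_c \<cdot> free_gen Gen_x \<cdot> v = free_gen Gen_x \<cdot> free_gen Gen_c \<cdot> v"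
  using relation[of "free_gen Gen_c * free_gen Gen_x" "free_gen Gen_x * free_gen Gen_c" v]
  by (simp add: H_relators_def Let_def act_mult act_closed)

lemma inverse_act:
  assumes "v \<in> carrier M"
  shows "free_gen Gen_a \<cdot> free_gen Gen_a_inv \<cdot> v = v" "free_gen Gen_a_inv \<cdot> free_gen Gen_a \<cdot> v = v"
    "free_gen Gen_b \<cdot> free_gen Gen_b_inv \<cdot> v = v" "free_gen Gen_b_inv \<cdot> free_gen Gen_b \<cdot> v = v"
    "free_gen Gen_c \<cdot> free_gen Gen_c_inv \<cdot> v = v" "free_gen Gen_c_inv \<cdot> free_gen Gen_c \<cdot> v = v"
  using relation[of "free_gen Gen_a * free_gen Gen_a_inv" 1 v] relation[of "free_gen Gen_a_inv * free_gen Gen_a" 1 v]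
    relation[of "free_gen Gen_b * free_gen Gen_b_inv" 1 v] relation[of "free_gen Gen_b_inv * free_gen Gen_b" 1 v]
    relation[of "free_gen Gen_c * free_gen Gen_c_inv" 1 v] relation[of "free_gen Gen_c_inv * free_gen Gen_c" 1 v]
    assms
  by (simp_all add: H_relators_def Let_def act_mult act_closed act_one)

lemma x_power_a: "v \<in> carrier M \<Longrightarrow>
    free_gen Gen_x ^ k \<cdot> free_gen Gen_a \<cdot> v = free_const (q ^ k) \<cdot> free_gen Gen_a \<cdot> free_gen Gen_x ^ k \<cdot> v"
proof (induction k)
  case 0
  then show ?case by (simp add: act_one act_closed free_const_hom)
next
  case (Suc k)
  let ?w = "free_gen Gen_x ^ k \<cdot> v"
  have "free_gen Gen_x ^ Suc k \<cdot> free_gen Gen_a \<cdot> v = free_gen Gen_x \<cdot> free_const (q ^ k) \<cdot> free_gen Gen_a \<cdot> ?w"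
    using Suc by (simp add: act_mult act_closed)
  also have "\<dots> = free_const (q ^ k) \<cdot> free_gen Gen_x \<cdot> free_gen Gen_a \<cdot> ?w"
    using Suc.prems by (simp add: act_const_commute[of _ "free_gen Gen_x"] act_closed)
  also have "\<dots> = free_const (q ^ Suc k) \<cdot> free_gen Gen_a \<cdot> free_gen Gen_x ^ Suc k \<cdot> v"
    using Suc.prems by (simp add: x_a act_closed act_mult free_const_hom(4) mult.commute[of q "q ^ k"])
  finally show ?case .
qed

lemma b_x_power: "v \<in> carrier M \<Longrightarrow> free_gen Gen_b \<cdot> free_gen Gen_x ^ k \<cdot> v = free_gen Gen_x ^ k \<cdot> free_gen Gen_b \<cdot> v"
  by (induction k) (simp_all add: act_one act_closed act_mult b_x)

lemma c_x_power: "v \<in> carrier M \<Longrightarrow> free_gen Gen_c \<cdot> free_gen Gen_x ^ k \<cdot> v = free_gen Gen_x ^ k \<cdot> free_gen Gen_c \<cdot> v"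
  by (induction k) (simp_all add: act_one act_closed act_mult c_x)

lemma x_power_first: "k < t \<Longrightarrow> free_gen Gen_x ^ k \<cdot> m 0 = m k"
  by (induction k) (simp_all add: act_one basis_closed act_mult x_basis)

lemma x_power_t: "v \<in> carrier M \<Longrightarrow> free_gen Gen_x ^ t \<cdot> v = \<zero>\<^bsub>M\<^esub>"
proof (rule act_zero_of_basis)
  fix j assume j: "j < t"
  have "free_gen Gen_x ^ Suc (t - Suc j) \<cdot> m j = \<zero>\<^bsub>M\<^esub>"
    using j
  proof (induction "t - Suc j" arbitrary: j)
    case 0
    then have "j = t - 1" by simp
    then show ?case using x_last by simp
  next
    case (Suc k)
    then have k: "Suc k = t - Suc j" "k = t - Suc (Suc j)" "Suc j < t" by auto
    have "free_gen Gen_x ^ Suc (t - Suc j) \<cdot> m j = free_gen Gen_x ^ Suc k \<cdot> free_gen Gen_x \<cdot> m j"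
      using Suc.prems by (simp only: k(1)[symmetric] power_Suc2[of _ "Suc k"] act_mult basis_closed)
    also have "\<dots> = \<zero>\<^bsub>M\<^esub>"
      using Suc.hyps(1)[OF k(2,3), folded k(2)] k(3) by (simp add: x_basis del: power_Suc)
    finally show ?case .
  qed
  then show "free_gen Gen_x ^ t \<cdot> m j = \<zero>\<^bsub>M\<^esub>"
    by (rule act_power_zero[OF basis_closed[OF j]]) (use j in simp)
qed

lemma y_power_t: "v \<in> carrier M \<Longrightarrow> free_gen Gen_y ^ t \<cdot> v = \<zero>\<^bsub>M\<^esub>"
proof (rule act_zero_of_basis)
  fix j assume j: "j < t"
  have "free_gen Gen_y ^ Suc j \<cdot> m j = \<zero>\<^bsub>M\<^esub>"
    using j
  proof (induction j)
    case 0
    then show ?case by (simp add: y_first)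
  next
    case (Suc j)
    have "free_gen Gen_y ^ Suc (Suc j) \<cdot> m (Suc j) = free_gen Gen_y ^ Suc j \<cdot> free_gen Gen_y \<cdot> m (Suc j)"
      using Suc.prems by (simp only: power_Suc2[of _ "Suc j"] act_mult basis_closed)
    also have "\<dots> = \<zero>\<^bsub>M\<^esub>"
      using Suc by (simp add: y_basis act_const_commute basis_closed act_zero_right del: power_Suc)
    finally show ?case .
  qed
  then show "free_gen Gen_y ^ t \<cdot> m j = \<zero>\<^bsub>M\<^esub>"
    by (rule act_power_zero[OF basis_closed[OF j]]) (use j in simp)
qed

text \<open>The image of \<open>y\<close> does not reach the last basis vector, and that of \<open>a - gq\<^sup>i\<close> does not reach the
  first one. This is what prevents the two extensions below from splitting.\<close>

lemma coord_y_last: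
  assumes "v \<in> carrier M"
  shows "coord (free_gen Gen_y \<cdot> v) (t - 1) = 0"
  using assms
proof (induction rule: basis_induct)
  case (basis j)
  show ?case
  proof (cases "j = 0")
    case True
    then show ?thesis using t_pos by (simp add: y_first coord_zero)
  next
    case False
    then show ?thesis
      using basis by (simp add: y_basis coord_const basis_closed coord_basis)
  qed
qed (use t_pos in \<open>simp_all add: act_zero_right coord_zero act_add_right coord_add act_closed
  act_const_commute coord_const\<close>)

lemma coord_a_first:
  assumes "v \<in> carrier M"
  shows "coord ((free_gen Gen_a - free_const (g * q powi i)) \<cdot> v) 0 = 0"
  using assms
proof (induction rule: basis_induct)
  case (basis j)
  have "(free_gen Gen_a - free_const (g * q powi i)) \<cdot> m j
     = free_const (g * q powi (i - int j) - g * q powi i) \<cdot> m j"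
    using basis by (simp add: a_basis act_diff_left basis_closed free_const_def single_diff)
  then show ?case
    using basis by (simp add: coord_const basis_closed coord_basis)
qed (use t_pos in \<open>simp_all add: act_zero_right coord_zero act_add_right coord_add act_closed
  act_const_commute coord_const\<close>)

end

lemma is_V_module_imp_V_module:
  assumes "is_V_module n n1 q \<beta>1 \<beta>2 \<beta>3 t g \<gamma>2 \<gamma>3 i M" and "0 < t"
  obtains m where "V_module M (quotient_act (H_ideal n n1 q \<beta>1 \<beta>2 \<beta>3) M) t m n n1 q \<beta>1 \<beta>2 \<beta>3 g \<gamma>2 \<gamma>3 i"
proof -
  let ?I = "H_ideal n n1 q \<beta>1 \<beta>2 \<beta>3"
  have I: "ideal ?I free_algebra"
    unfolding H_ideal_def by (rule ideal_type_algebra_Idl)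
  have LM: "left_module (free_algebra Quot ?I) M"
    using assms(1) by (simp add: is_V_module_def H_algebra_def)
  interpret action M "quotient_act ?I M"
    by (rule quotient_action[OF I LM])
  have rel: "r \<in> ?I" if "r \<in> H_relators n n1 q \<beta>1 \<beta>2 \<beta>3" for r
    unfolding H_ideal_def using that ring.genideal_self[OF ring_type_algebra, of "H_relators n n1 q \<beta>1 \<beta>2 \<beta>3"]
    by (auto simp: type_algebra_simps)
  obtain m where m: "m \<in> {..<t} \<rightarrow> carrier M"
      "\<forall>v\<in>carrier M. \<exists>!\<kappa>. \<kappa> \<in> {..<t} \<rightarrow>\<^sub>E UNIV \<and>
        v = (\<Oplus>\<^bsub>M\<^esub>j\<in>{..<t}. quotient_act ?I M (free_const (\<kappa> j)) (m j))"
    and gens: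
      "\<forall>j<t. quotient_act ?I M (free_gen Gen_a) (m j) = quotient_act ?I M (free_const (g * q powi (i - int j))) (m j)"
      "\<forall>j<t. quotient_act ?I M (free_gen Gen_b) (m j) = quotient_act ?I M (free_const \<gamma>2) (m j)"
      "\<forall>j<t. quotient_act ?I M (free_gen Gen_c) (m j) = quotient_act ?I M (free_const \<gamma>3) (m j)"
      "\<forall>j<t - 1. quotient_act ?I M (free_gen Gen_x) (m j) = m (j + 1)"
      "quotient_act ?I M (free_gen Gen_x) (m (t - 1)) = \<zero>\<^bsub>M\<^esub>"
      "quotient_act ?I M (free_gen Gen_y) (m 0) = \<zero>\<^bsub>M\<^esub>"
      "\<forall>l. 1 \<le> l \<and> l \<le> t - 1 \<longrightarrow> quotient_act ?I M (free_gen Gen_y) (m l)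
        = quotient_act ?I M (free_const (V_coeff n1 q \<beta>3 g \<gamma>2 \<gamma>3 i l)) (m (l - 1))"
    using assms(1) unfolding is_V_module_def Let_def H_class_def by blast
  have "V_module M (quotient_act ?I M) t m n n1 q \<beta>1 \<beta>2 \<beta>3 g \<gamma>2 \<gamma>3 i"
  proof (unfold_locales, goal_cases)
    case (2 v)
    then show ?case using m(2) by (rule bspec[rotated])
  next
    case (4 r v)
    then show ?case by (intro quotient_act_ideal[OF I LM rel])
  qed (use m(1) gens assms(2) in \<open>simp_all add: Pi_iff\<close>)
  then show thesis by (rule that)
qed

text \<open>The two modules of the theorem, with \<open>M\<close> the quotient and \<open>N\<close> the submodule of the extension.\<close>

locale V_pair =
  M: V_module M actM t m n n1 q \<beta>1 \<beta>2 \<beta>3 g \<gamma>2 \<gamma>3 "i - int t + int n" +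
  N: V_module N actN t m' n n1 q \<beta>1 \<beta>2 \<beta>3 g \<gamma>2 \<gamma>3 i
  for M :: "('a, 'v) ring_scheme" and actM :: "(word \<Rightarrow>\<^sub>0 'k::field) \<Rightarrow> 'a \<Rightarrow> 'a" (infixr "\<cdot>\<^sub>M" 75)
    and N :: "('b, 'w) ring_scheme" and actN :: "(word \<Rightarrow>\<^sub>0 'k) \<Rightarrow> 'b \<Rightarrow> 'b" (infixr "\<cdot>\<^sub>N" 75)
    and t :: nat and m :: "nat \<Rightarrow> 'a" and m' :: "nat \<Rightarrow> 'b"
    and n n1 :: nat and q \<beta>1 \<beta>2 \<beta>3 g \<gamma>2 \<gamma>3 :: 'k and i :: int +
  assumes q_power_n: "q ^ n = 1" and n_pos: "0 < n" and q_power_t: "q ^ (t * n1) = 1"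
begin

sublocale based_pair M actM N actN t m m' ..

lemma q_nonzero: "q \<noteq> 0"
  using q_power_n n_pos by (auto simp: power_0_left)

text \<open>Since \<open>q\<^sup>n = q\<^bsup>t n\<^sub>1\<^esup> = 1\<close>, the coefficients of \<open>y\<close> in the two modules agree. Hence \<open>\<phi>\<close> commutes
  with \<open>b\<close>, \<open>c\<close>, \<open>x\<close> and \<open>y\<close>, and with \<open>a\<close> up to the factor \<open>q\<^bsup>-t\<^esup>\<close>.\<close>

lemma V_coeff_shift: "V_coeff n1 q \<beta>3 g \<gamma>2 \<gamma>3 (i - int t + int n) l = V_coeff n1 q \<beta>3 g \<gamma>2 \<gamma>3 i l"
proof -
  have "(2 * (i - int t + int n) - int l + 1) * int n1
      = (2 * i - int l + 1) * int n1 + (int n * (2 * int n1) - int (t * n1) * 2)"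
    by (simp add: algebra_simps)
  moreover have "q powi (int n * (2 * int n1) - int (t * n1) * 2) = 1"
    by (simp only: power_int_diff[OF disjI1[OF q_nonzero]] power_int_mult power_int_of_nat q_power_n q_power_t) simp
  ultimately have "q powi ((2 * (i - int t + int n) - int l + 1) * int n1) = q powi ((2 * i - int l + 1) * int n1)"
    by (simp only: power_int_add[OF disjI1[OF q_nonzero]]) simp
  then show ?thesis unfolding V_coeff_def by (simp only:)
qed

lemma \<phi>_b: "v \<in> carrier M \<Longrightarrow> \<phi> (free_gen Gen_b \<cdot>\<^sub>M v) = free_gen Gen_b \<cdot>\<^sub>N \<phi> v"
  by (rule \<phi>_intertwines) (simp_all add: M.b_basis N.b_basis \<phi>_const M.basis_closed \<phi>_basis)

lemma \<phi>_c: "v \<in> carrier M \<Longrightarrow> \<phi> (free_gen Gen_c \<cdot>\<^sub>M v) = free_gen Gen_c \<cdot>\<^sub>N \<phi> v"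
  by (rule \<phi>_intertwines) (simp_all add: M.c_basis N.c_basis \<phi>_const M.basis_closed \<phi>_basis)

lemma \<phi>_x: "v \<in> carrier M \<Longrightarrow> \<phi> (free_gen Gen_x \<cdot>\<^sub>M v) = free_gen Gen_x \<cdot>\<^sub>N \<phi> v"
proof (rule \<phi>_intertwines)
  fix j assume j: "j < t"
  show "\<phi> (free_gen Gen_x \<cdot>\<^sub>M m j) = free_gen Gen_x \<cdot>\<^sub>N m' j"
  proof (cases "j = t - 1")
    case True
    then show ?thesis using M.x_last N.x_last by (simp add: \<phi>_zero)
  next
    case False
    then show ?thesis using j by (simp add: M.x_basis N.x_basis \<phi>_basis)
  qed
qed

lemma \<phi>_y: "v \<in> carrier M \<Longrightarrow> \<phi> (free_gen Gen_y \<cdot>\<^sub>M v) = free_gen Gen_y \<cdot>\<^sub>N \<phi> v"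
proof (rule \<phi>_intertwines)
  fix j assume j: "j < t"
  show "\<phi> (free_gen Gen_y \<cdot>\<^sub>M m j) = free_gen Gen_y \<cdot>\<^sub>N m' j"
  proof (cases "j = 0")
    case True
    then show ?thesis by (simp add: M.y_first N.y_first \<phi>_zero)
  next
    case False
    then show ?thesis
      using j by (simp add: M.y_basis N.y_basis \<phi>_basis \<phi>_const M.basis_closed V_coeff_shift)
  qed
qed

lemma \<phi>_a: "v \<in> carrier M \<Longrightarrow>
    \<phi> (free_gen Gen_a \<cdot>\<^sub>M v) = free_const (q powi (- int t)) \<cdot>\<^sub>N free_gen Gen_a \<cdot>\<^sub>N \<phi> v"
proof -
  assume v: "v \<in> carrier M"
  have "\<phi> (free_gen Gen_a \<cdot>\<^sub>M v) = (free_const (q powi (- int t)) * free_gen Gen_a) \<cdot>\<^sub>N \<phi> v"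
  proof (rule \<phi>_intertwines[OF _ v])
    fix j assume j: "j < t"
    have "q powi (i - int t + int n - int j) = q powi (- int t) * q powi (i - int j)"
    proof -
      have "i - int t + int n - int j = (- int t + (i - int j)) + int n" by simp
      then show ?thesis
        by (simp only: power_int_add[OF disjI1[OF q_nonzero]] power_int_of_nat q_power_n) simp
    qed
    moreover have "(free_const (q powi (- int t)) * free_gen Gen_a) \<cdot>\<^sub>N m' j
        = free_const (q powi (- int t) * (g * q powi (i - int j))) \<cdot>\<^sub>N m' j"
      using j by (simp only: N.act_mult N.basis_closed N.a_basis free_const_hom(4) N.act_closed)
    ultimately show "\<phi> (free_gen Gen_a \<cdot>\<^sub>M m j) = (free_const (q powi (- int t)) * free_gen Gen_a) \<cdot>\<^sub>N m' j"
      using j by (simp add: M.a_basis \<phi>_const M.basis_closed \<phi>_basis mult.left_commute)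
  qed
  then show ?thesis by (simp add: N.act_mult \<phi>_closed)
qed

end

section \<open>The extension for \<open>t < n\<close>\<close>

context V_pair
begin

text \<open>The modification \<open>y m\<^sub>0 = m'\<^bsub>t-1\<^esub>\<close> of the direct sum, all other actions on the basis being
  unchanged. It is written without reference to the basis: on \<open>N\<close>, the operator \<open>x\<^bsup>t-1\<^esup>\<close> maps \<open>m'\<^sub>0\<close>
  to \<open>m'\<^bsub>t-1\<^esub>\<close> and annihilates the other basis vectors.\<close>

definition \<delta>_low :: "gen \<Rightarrow> 'a \<Rightarrow> 'b" where
  "\<delta>_low u v = (if u = Gen_y then free_gen Gen_x ^ (t - 1) \<cdot>\<^sub>N \<phi> v else \<zero>\<^bsub>N\<^esub>)"

lemma free_crossed_low: "free_crossed M actM N actN \<delta>_low"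
  by unfold_locales
    (auto simp: \<delta>_low_def N.act_closed \<phi>_closed \<phi>_add \<phi>_const N.act_add_right N.act_const_commute N.act_zero_right)

interpretation L: free_crossed M actM N actN \<delta>_low
  by (rule free_crossed_low)

text \<open>For a divisor \<open>t\<close> of \<open>n\<close> the hypothesis \<open>2t \<le> n\<close> amounts to \<open>t < n\<close>. It is used for the relator of
  \<open>y\<^sup>n\<close> only, but there it matters: for \<open>t = n\<close> the modified \<open>y\<^sup>n\<close> need not vanish.\<close>

lemma crossed_low_relator:
  assumes "2 * t \<le> n" and "r \<in> H_relators n n1 q \<beta>1 \<beta>2 \<beta>3" and v: "v \<in> carrier M"
  shows "L.crossed r v = \<zero>\<^bsub>N\<^esub>"
proof -
  \<comment> \<open>\<open>flat p\<close> says that \<open>p\<close> acts as it does on the direct sum; this holds for all \<open>p\<close> without \<open>y\<close>.\<close>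
  define flat where "flat p \<longleftrightarrow> (\<forall>v\<in>carrier M. L.crossed p v = \<zero>\<^bsub>N\<^esub>)" for p
  have flat_mult: "flat (p * p')" if "flat p" "flat p'" for p p'
    using that by (simp add: flat_def L.crossed_mult N.act_zero_right M.act_closed)
  have flat_eqI: "flat (p - p')" if "\<And>v. v \<in> carrier M \<Longrightarrow> L.crossed p v = L.crossed p' v" for p p'
    using that by (simp add: flat_def L.crossed_diff_left L.crossed_closed N.M.minus_eq N.M.r_neg)
  have flat_diff: "flat (p - p')" if "flat p" "flat p'" for p p'
    by (rule flat_eqI) (use that in \<open>simp add: flat_def\<close>)
  have flat_const: "flat (free_const c)" for c
    by (simp add: flat_def L.crossed_const)
  have flat_one: "flat 1"
    using flat_const[of 1] by (simp add: free_const_hom)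
  have flat_power: "flat (p ^ k)" if "flat p" for p k
    by (induction k) (simp_all add: flat_one flat_mult that)
  have flat_gen: "flat (free_gen u)" if "u \<noteq> Gen_y" for u
    using that by (simp add: flat_def L.crossed_gen \<delta>_low_def)
  note flat = flat_mult flat_diff flat_one flat_const flat_power flat_gen
  have crossed_gen: "L.crossed (free_gen u) w = \<zero>\<^bsub>N\<^esub>" if "u \<noteq> Gen_y" "w \<in> carrier M" for u w
    using that by (simp add: L.crossed_gen \<delta>_low_def)
  have crossed_y: "L.crossed (free_gen Gen_y) w = free_gen Gen_x ^ (t - 1) \<cdot>\<^sub>N \<phi> w" if "w \<in> carrier M" for w
    using that by (simp add: L.crossed_gen \<delta>_low_def)
  have x_t: "free_gen Gen_x \<cdot>\<^sub>N free_gen Gen_x ^ (t - 1) \<cdot>\<^sub>N w = \<zero>\<^bsub>N\<^esub>"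
    "free_gen Gen_x ^ (t - 1) \<cdot>\<^sub>N free_gen Gen_x \<cdot>\<^sub>N w = \<zero>\<^bsub>N\<^esub>" if w: "w \<in> carrier N" for w
  proof -
    have "free_gen Gen_x ^ t = free_gen Gen_x * (free_gen Gen_x :: word \<Rightarrow>\<^sub>0 'k) ^ (t - 1)"
      "free_gen Gen_x ^ t = (free_gen Gen_x :: word \<Rightarrow>\<^sub>0 'k) ^ (t - 1) * free_gen Gen_x"
      using power_minus_mult[OF M.t_pos, of "free_gen Gen_x :: word \<Rightarrow>\<^sub>0 'k"] by (simp_all add: power_commutes)
    then show "free_gen Gen_x \<cdot>\<^sub>N free_gen Gen_x ^ (t - 1) \<cdot>\<^sub>N w = \<zero>\<^bsub>N\<^esub>"
      "free_gen Gen_x ^ (t - 1) \<cdot>\<^sub>N free_gen Gen_x \<cdot>\<^sub>N w = \<zero>\<^bsub>N\<^esub>"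
      using N.x_power_t[OF w] w by (simp_all flip: N.act_mult)
  qed
  have ya: "flat (free_gen Gen_y * free_gen Gen_a - free_const (inverse q) * (free_gen Gen_a * free_gen Gen_y))"
  proof (rule flat_eqI)
    fix w assume w: "w \<in> carrier M"
    let ?z = "free_gen Gen_a \<cdot>\<^sub>N free_gen Gen_x ^ (t - 1) \<cdot>\<^sub>N \<phi> w"
    \<comment> \<open>The twist \<open>q\<^bsup>-t\<^esup>\<close> of \<open>\<phi>\<close> and the factor \<open>q\<^bsup>t-1\<^esup>\<close> from moving \<open>a\<close> past \<open>x\<^bsup>t-1\<^esup>\<close> combine to \<open>q\<^sup>-\<^sup>1\<close>.\<close>
    have "q powi (- int t) * q ^ (t - 1) = inverse q"
    proof -
      have "q ^ t = q * q ^ (t - 1)" using power_minus_mult[OF M.t_pos, of q] by (simp add: mult.commute)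
      then show ?thesis using q_nonzero by (simp add: power_int_minus field_simps)
    qed
    moreover have "free_const (q powi (- int t)) \<cdot>\<^sub>N free_const (q ^ (t - 1)) \<cdot>\<^sub>N ?z
        = free_const (q powi (- int t) * q ^ (t - 1)) \<cdot>\<^sub>N ?z"
      by (simp add: N.act_closed \<phi>_closed N.act_mult free_const_hom(4))
    ultimately show "L.crossed (free_gen Gen_y * free_gen Gen_a) w =
        L.crossed (free_const (inverse q) * (free_gen Gen_a * free_gen Gen_y)) w"
      using w by (simp add: L.crossed_mult crossed_gen crossed_y L.crossed_const N.act_zero_right M.act_closed
          N.act_closed \<phi>_closed \<phi>_a N.act_const_commute[of _ "free_gen Gen_x ^ (t - 1)"] N.x_power_a
          del: One_nat_def)
  qed
  have central: "flat (free_gen u * free_gen Gen_y - free_gen Gen_y * free_gen u)" if "u = Gen_b \<or> u = Gen_c" for u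
  proof (rule flat_eqI)
    fix w assume w: "w \<in> carrier M"
    have u: "u \<noteq> Gen_y" "\<phi> (free_gen u \<cdot>\<^sub>M w) = free_gen u \<cdot>\<^sub>N \<phi> w"
      "free_gen u \<cdot>\<^sub>N free_gen Gen_x ^ (t - 1) \<cdot>\<^sub>N \<phi> w = free_gen Gen_x ^ (t - 1) \<cdot>\<^sub>N free_gen u \<cdot>\<^sub>N \<phi> w"
      using that w by (auto simp: \<phi>_b \<phi>_c N.b_x_power N.c_x_power \<phi>_closed)
    then show "L.crossed (free_gen u * free_gen Gen_y) w = L.crossed (free_gen Gen_y * free_gen u) w"
      using w by (simp add: L.crossed_mult crossed_gen crossed_y N.act_zero_right M.act_closed N.act_closed \<phi>_closed)
  qed
  have yx: "flat (free_gen Gen_y * free_gen Gen_x)" "flat (free_gen Gen_x * free_gen Gen_y)"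
    by (simp_all add: flat_def L.crossed_mult crossed_gen crossed_y N.act_zero_right M.act_closed N.act_closed
        \<phi>_closed \<phi>_x x_t del: One_nat_def)
  \<comment> \<open>\<open>y\<^sup>n = y\<^sup>t y\<^bsup>n-t\<^esup>\<close>, and both \<open>y\<^sup>t\<close> and \<open>y\<^bsup>n-t\<^esup>\<close> annihilate both modules.\<close>
  have yn: "flat (free_gen Gen_y ^ n)"
  proof -
    have "(free_gen Gen_y :: word \<Rightarrow>\<^sub>0 'k) ^ n = free_gen Gen_y ^ t * free_gen Gen_y ^ (n - t)"
      using assms(1) by (simp flip: power_add)
    moreover have "free_gen Gen_y ^ (n - t) \<cdot>\<^sub>M w = \<zero>\<^bsub>M\<^esub>" if "w \<in> carrier M" for w
      by (rule M.act_power_zero[OF that M.y_power_t[OF that]]) (use assms(1) in simp)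
    ultimately show ?thesis
      by (simp add: flat_def L.crossed_mult L.crossed_zero_right N.y_power_t L.crossed_closed)
  qed
  have "flat r"
    using assms(2) unfolding H_relators_def Let_def
    by (elim insertE emptyE; hypsubst;
        intro ya central yx yn flat; simp)
  then show ?thesis using v by (simp add: flat_def)
qed

lemma crossed_low_nonsplit:
  assumes w: "w \<in> carrier N"
  shows "L.crossed (free_gen Gen_y) (m 0) \<noteq> free_gen Gen_y \<cdot>\<^sub>N w"
proof
  assume eq: "L.crossed (free_gen Gen_y) (m 0) = free_gen Gen_y \<cdot>\<^sub>N w"
  have "L.crossed (free_gen Gen_y) (m 0) = m' (t - 1)"
    using M.t_pos by (simp add: L.crossed_gen M.basis_closed \<delta>_low_def \<phi>_basis N.x_power_first)
  then show False
    using eq N.coord_y_last[OF w] N.coord_basis[of "t - 1" "t - 1"] M.t_pos by simp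
qed

section \<open>The extension for \<open>t = n\<close>\<close>

text \<open>The relators of \<open>H\<^sub>\<beta>\<close> are homogeneous when \<open>a\<close> has degree 1 and \<open>b\<close>, \<open>c\<close>, \<open>x\<close>, \<open>y\<close> have degree
  \<open>n\<^sub>1\<close>, so \<open>H\<^sub>\<beta>\<close> carries the derivation \<open>\<partial>\<close> that multiplies an element of degree \<open>e\<close> by \<open>e\<close>.\<close>

definition gen_degree :: "gen \<Rightarrow> int" where
  "gen_degree u = (case u of Gen_a \<Rightarrow> 1 | Gen_a_inv \<Rightarrow> - 1 | Gen_b_inv \<Rightarrow> - int n1 | Gen_c_inv \<Rightarrow> - int n1
    | _ \<Rightarrow> int n1)"

text \<open>For \<open>t = n\<close> the map \<open>\<phi>\<close> is an isomorphism of modules, and the crossed map is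
  \<open>D(p, v) = \<partial>(p) \<phi>(v)\<close>. It describes the infinitesimal deformation of \<open>N\<close> that rescales each
  generator according to its degree.\<close>

definition \<delta>_degree :: "gen \<Rightarrow> 'a \<Rightarrow> 'b" where
  "\<delta>_degree u v = free_const (of_int (gen_degree u)) \<cdot>\<^sub>N free_gen u \<cdot>\<^sub>N \<phi> v"

lemma free_crossed_degree: "free_crossed M actM N actN \<delta>_degree"
proof unfold_locales
  fix u v c assume v: "v \<in> carrier M"
  have "free_const (of_int (gen_degree u)) \<cdot>\<^sub>N free_gen u \<cdot>\<^sub>N free_const c \<cdot>\<^sub>N \<phi> v
      = free_const c \<cdot>\<^sub>N free_const (of_int (gen_degree u)) \<cdot>\<^sub>N free_gen u \<cdot>\<^sub>N \<phi> v"
    by (metis N.act_const_commute N.act_closed \<phi>_closed)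
  then show "\<delta>_degree u (free_const c \<cdot>\<^sub>M v) = free_const c \<cdot>\<^sub>N \<delta>_degree u v"
    using v by (simp add: \<delta>_degree_def \<phi>_const)
qed (auto simp: \<delta>_degree_def N.act_closed \<phi>_closed \<phi>_add N.act_add_right)

interpretation E: free_crossed M actM N actN \<delta>_degree
  by (rule free_crossed_degree)

lemma \<phi>_linear:
  assumes t: "t = n" and v: "v \<in> carrier M"
  shows "\<phi> (p \<cdot>\<^sub>M v) = p \<cdot>\<^sub>N \<phi> v"
proof -
  have a: "\<phi> (free_gen Gen_a \<cdot>\<^sub>M w) = free_gen Gen_a \<cdot>\<^sub>N \<phi> w" if "w \<in> carrier M" for w
  proof -
    have "q powi (- int t) = 1" using q_power_n t by (simp add: power_int_minus)
    then show ?thesis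
      using \<phi>_a[OF that] by (simp add: free_const_hom(2) N.act_one N.act_closed \<phi>_closed)
  qed
  have inv: "\<phi> (free_gen u' \<cdot>\<^sub>M w) = free_gen u' \<cdot>\<^sub>N \<phi> w"
    if "\<And>w. w \<in> carrier M \<Longrightarrow> \<phi> (free_gen u \<cdot>\<^sub>M w) = free_gen u \<cdot>\<^sub>N \<phi> w"
      and "\<And>w. w \<in> carrier M \<Longrightarrow> free_gen u \<cdot>\<^sub>M free_gen u' \<cdot>\<^sub>M w = w"
      and "\<And>w. w \<in> carrier N \<Longrightarrow> free_gen u' \<cdot>\<^sub>N free_gen u \<cdot>\<^sub>N w = w"
      and "w \<in> carrier M" for u u' w
    by (metis that M.act_closed \<phi>_closed)
  have gen: "\<phi> (free_gen u \<cdot>\<^sub>M w) = free_gen u \<cdot>\<^sub>N \<phi> w" if w: "w \<in> carrier M" for u w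
  proof (cases u)
    case Gen_a_inv
    then show ?thesis using inv[OF a M.inverse_act(1) N.inverse_act(2) w] by simp
  next
    case Gen_b_inv
    then show ?thesis using inv[OF \<phi>_b M.inverse_act(3) N.inverse_act(4) w] by simp
  next
    case Gen_c_inv
    then show ?thesis using inv[OF \<phi>_c M.inverse_act(5) N.inverse_act(6) w] by simp
  qed (use w in \<open>simp_all add: a \<phi>_b \<phi>_c \<phi>_x \<phi>_y\<close>)
  have word: "\<phi> (free_word w \<cdot>\<^sub>M v) = free_word w \<cdot>\<^sub>N \<phi> v" for w
    by (induction w) (simp_all add: free_word_Nil free_word_Cons v M.act_one N.act_one \<phi>_closed
      M.act_mult N.act_mult M.act_closed gen)
  show ?thesis
    by (induction p rule: free_algebra_induct)
      (simp_all add: single_eq_free_word v M.act_mult N.act_mult \<phi>_closed \<phi>_const M.act_closed word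
        M.act_add_left N.act_add_left \<phi>_add)
qed

text \<open>The weak form of homogeneity of degree \<open>e\<close> that can be tested on \<open>M\<close> and \<open>N\<close>:
  \<open>\<partial>(p)\<close> and \<open>e p\<close> act in the same way.\<close>

definition homogeneous :: "int \<Rightarrow> (word \<Rightarrow>\<^sub>0 'k) \<Rightarrow> bool" where
  "homogeneous e p \<longleftrightarrow> (\<forall>v\<in>carrier M. E.crossed p v = free_const (of_int e) \<cdot>\<^sub>N p \<cdot>\<^sub>N \<phi> v)"

lemma homogeneous_gen: "homogeneous (gen_degree u) (free_gen u)"
  by (simp add: homogeneous_def E.crossed_gen \<delta>_degree_def)

lemma homogeneous_const: "homogeneous 0 (free_const c)"
  by (simp add: homogeneous_def E.crossed_const free_const_hom N.act_zero_left N.act_closed \<phi>_closed)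

lemma homogeneous_one: "homogeneous 0 1"
  using homogeneous_const[of 1] by (simp add: free_const_hom)

lemma homogeneous_mult:
  assumes "t = n" and "homogeneous e p" and "homogeneous e' p'"
  shows "homogeneous (e + e') (p * p')"
  unfolding homogeneous_def
proof
  fix v assume v: "v \<in> carrier M"
  let ?z = "p \<cdot>\<^sub>N p' \<cdot>\<^sub>N \<phi> v"
  have "E.crossed (p * p') v = p \<cdot>\<^sub>N free_const (of_int e') \<cdot>\<^sub>N p' \<cdot>\<^sub>N \<phi> v \<oplus>\<^bsub>N\<^esub> free_const (of_int e) \<cdot>\<^sub>N ?z"
    using v assms(2,3) by (simp add: E.crossed_mult homogeneous_def M.act_closed \<phi>_linear[OF assms(1)])
  also have "p \<cdot>\<^sub>N free_const (of_int e') \<cdot>\<^sub>N p' \<cdot>\<^sub>N \<phi> v = free_const (of_int e') \<cdot>\<^sub>N ?z"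
    by (rule N.act_const_commute) (simp add: N.act_closed \<phi>_closed)
  also have "free_const (of_int e') \<cdot>\<^sub>N ?z \<oplus>\<^bsub>N\<^esub> free_const (of_int e) \<cdot>\<^sub>N ?z = free_const (of_int (e + e')) \<cdot>\<^sub>N ?z"
    by (simp add: free_const_hom(3) N.act_add_left N.act_closed \<phi>_closed N.M.a_comm)
  finally show "E.crossed (p * p') v = free_const (of_int (e + e')) \<cdot>\<^sub>N (p * p') \<cdot>\<^sub>N \<phi> v"
    by (simp add: N.act_mult \<phi>_closed)
qed

lemma homogeneous_diff:
  assumes "homogeneous e p" and "homogeneous e p'"
  shows "homogeneous e (p - p')"
  unfolding homogeneous_def
proof
  fix v assume v: "v \<in> carrier M"
  have "E.crossed (p - p') v = (free_const (of_int e) * p - free_const (of_int e) * p') \<cdot>\<^sub>N \<phi> v"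
    using v assms by (simp add: E.crossed_diff_left homogeneous_def N.act_diff_left \<phi>_closed N.act_mult)
  then show "E.crossed (p - p') v = free_const (of_int e) \<cdot>\<^sub>N (p - p') \<cdot>\<^sub>N \<phi> v"
    by (simp add: N.act_mult \<phi>_closed flip: right_diff_distrib)
qed

lemma homogeneous_power:
  assumes "t = n" and "homogeneous e p"
  shows "homogeneous (int k * e) (p ^ k)"
proof (induction k)
  case 0
  show ?case using homogeneous_one by simp
next
  case (Suc k)
  then show ?case
    using homogeneous_mult[OF assms Suc.IH] by (simp add: algebra_simps)
qed

lemma homogeneous_relator:
  assumes t: "t = n" and "r \<in> H_relators n n1 q \<beta>1 \<beta>2 \<beta>3"
  shows "\<exists>e. homogeneous e r"
proof -
  have mult: "homogeneous e'' (p * p')" if "homogeneous e p" "homogeneous e' p'" "e + e' = e''" for e e' e'' p p'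
    using homogeneous_mult[OF t that(1,2)] that(3) by simp
  have power: "homogeneous e' (p ^ k)" if "homogeneous e p" "int k * e = e'" for e e' p k
    using homogeneous_power[OF t that(1), of k] that(2) by simp
  have sub: "\<exists>e. homogeneous e (p - p')" if "homogeneous e p" "homogeneous e p'" for e p p'
    using homogeneous_diff[OF that] by blast
  have gen: "homogeneous e (free_gen u)" if "gen_degree u = e" for e u
    using homogeneous_gen[of u] that by simp
  have const: "homogeneous e (free_const c)" if "0 = e" for e c
    using homogeneous_const[of c] that by simp
  have one: "homogeneous e 1" if "0 = e" for e
    using homogeneous_one that by simp
  show ?thesis
    using assms(2) unfolding H_relators_def Let_def
    \<comment> \<open>The minuend of a relator determines \<open>e\<close>, with which the degree of the subtrahend is compared.\<close>
    apply (elim insertE emptyE; hypsubst_thin)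
    apply (rule sub homogeneous_diff mult power gen const one refl | (simp add: gen_degree_def; fail))+
    done
qed

lemma crossed_degree_relator:
  assumes "t = n" and r: "r \<in> H_relators n n1 q \<beta>1 \<beta>2 \<beta>3" and "v \<in> carrier M"
  shows "E.crossed r v = \<zero>\<^bsub>N\<^esub>"
  using homogeneous_relator[OF assms(1,2)] N.relator[OF r \<phi>_closed] assms(3)
  by (auto simp: homogeneous_def N.act_zero_right)

lemma crossed_degree_nonsplit:
  assumes t: "t = n" and g: "g \<noteq> 0" and w: "w \<in> carrier N"
  shows "E.crossed (free_gen Gen_a - free_const (g * q powi i)) (m 0)
    \<noteq> (free_gen Gen_a - free_const (g * q powi i)) \<cdot>\<^sub>N w"
proof
  assume eq: "E.crossed (free_gen Gen_a - free_const (g * q powi i)) (m 0)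
    = (free_gen Gen_a - free_const (g * q powi i)) \<cdot>\<^sub>N w"
  have "E.crossed (free_gen Gen_a - free_const (g * q powi i)) (m 0) = free_gen Gen_a \<cdot>\<^sub>N m' 0"
    using M.t_pos
    by (simp add: E.crossed_diff_left M.basis_closed E.crossed_gen E.crossed_const \<delta>_degree_def gen_degree_def
        free_const_hom(2) N.act_one N.act_closed \<phi>_basis N.basis_closed N.M.minus_eq)
  also have "\<dots> = free_const (g * q powi i) \<cdot>\<^sub>N m' 0"
    using N.a_basis[of 0] M.t_pos by simp
  finally have "N.coord (free_const (g * q powi i) \<cdot>\<^sub>N m' 0) 0 = 0"
    using eq N.coord_a_first[OF w] by simp
  then show False
    using M.t_pos g q_nonzero by (simp add: N.coord_const N.basis_closed N.coord_basis)
qed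

lemma exists_nonsplit_crossed:
  assumes "2 * t \<le> n \<or> t = n \<and> g \<noteq> 0"
  obtains \<delta> p where "free_crossed M actM N actN \<delta>"
    and "\<And>r v. \<lbrakk>r \<in> H_relators n n1 q \<beta>1 \<beta>2 \<beta>3; v \<in> carrier M\<rbrakk> \<Longrightarrow>
      free_crossed.crossed actM N actN \<delta> r v = \<zero>\<^bsub>N\<^esub>"
    and "p \<cdot>\<^sub>M m 0 = \<zero>\<^bsub>M\<^esub>"
    and "\<And>w. w \<in> carrier N \<Longrightarrow> free_crossed.crossed actM N actN \<delta> p (m 0) \<noteq> p \<cdot>\<^sub>N w"
  using assms
proof
  assume "2 * t \<le> n"
  then show thesis
    by (rule that[OF free_crossed_low crossed_low_relator M.y_first crossed_low_nonsplit])
next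
  assume "t = n \<and> g \<noteq> 0"
  then have t: "t = n" and g: "g \<noteq> 0" by auto
  have "(free_gen Gen_a - free_const (g * q powi i)) \<cdot>\<^sub>M m 0 = \<zero>\<^bsub>M\<^esub>"
    using M.a_basis[of 0] M.t_pos t
    by (simp add: M.act_diff_left M.basis_closed M.act_closed M.M.minus_eq M.M.r_neg)
  then show thesis
    using crossed_degree_relator[OF t] crossed_degree_nonsplit[OF t g] that[OF free_crossed_degree] by blast
qed

end

section \<open>Nonvanishing of the extension group\<close>

lemma mult_order_dvd:
  fixes z :: "'k::field"
  assumes "0 < k" and "z ^ k = 1"
  shows "0 < mult_order z" and "z ^ mult_order z = 1" and "mult_order z dvd k"
proof -
  have ord: "0 < mult_order z \<and> z ^ mult_order z = 1"
    unfolding mult_order_def using assms by (intro LeastI) auto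
  then show "0 < mult_order z" "z ^ mult_order z = 1" by auto
  have "z ^ (k mod mult_order z) = 1"
  proof -
    have "z ^ k = (z ^ mult_order z) ^ (k div mult_order z) * z ^ (k mod mult_order z)"
      by (simp only: power_mult[symmetric] power_add[symmetric] mult_div_mod_eq)
    then show ?thesis using assms ord by simp
  qed
  moreover have "k mod mult_order z < mult_order z" using ord by simp
  ultimately have "k mod mult_order z = 0"
    using not_less_Least[of "k mod mult_order z" "\<lambda>k. 0 < k \<and> z ^ k = 1"] by (auto simp: mult_order_def)
  then show "mult_order z dvd k" by auto
qed

theorem proposition4p6:
  fixes q \<beta>1 \<beta>2 \<beta>3 \<gamma>1 \<gamma>2 \<gamma>3 g :: "'k::{alg_closed_field, field_char_0}"
    and n n1 t :: nat and i :: int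
    and M :: "((word \<Rightarrow>\<^sub>0 'k) set, 'm) module"
    and N :: "((word \<Rightarrow>\<^sub>0 'k) set, 'n) module"
  assumes "n \<ge> 2" and "primitive_root_of_unity n q"
    and "1 \<le> n1" and "n1 \<le> n" and "\<not> 2 dvd gcd n n1"
    and "\<gamma>1 \<noteq> 0" and "\<gamma>2 \<noteq> 0" and "\<gamma>3 \<noteq> 0" and "g ^ n = \<gamma>1"
    and "\<beta>3 \<noteq> 0"
    and "\<forall>v::int. inverse (g ^ (2 * n1)) * \<gamma>2 * \<gamma>3 \<noteq> q powi (v * int n1)"
    and "(\<gamma>1 ^ n1 - \<gamma>2 ^ n) * \<beta>1 = 0" and "(\<gamma>1 ^ n1 - \<gamma>3 ^ n) * \<beta>2 = 0"
    and "t = mult_order (q ^ n1)"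
    and "1 \<le> i" and "i \<le> int n - 1"
    and "is_V_module n n1 q \<beta>1 \<beta>2 \<beta>3 t g \<gamma>2 \<gamma>3 (i - int t + int n) M"
    and "is_V_module n n1 q \<beta>1 \<beta>2 \<beta>3 t g \<gamma>2 \<gamma>3 i N"
  shows "carrier (Ext1 (H_algebra n n1 q \<beta>1 \<beta>2 \<beta>3) M N)
           \<noteq> {\<one>\<^bsub>Ext1 (H_algebra n n1 q \<beta>1 \<beta>2 \<beta>3) M N\<^esub>}"
proof -
  let ?I = "H_ideal n n1 q \<beta>1 \<beta>2 \<beta>3"
  have n: "0 < n" using assms(1) by simp
  have qn: "q ^ n = 1" using assms(2) by (simp add: primitive_root_of_unity_def)
  have "(q ^ n1) ^ n = (q ^ n) ^ n1" by (simp only: power_mult[symmetric] mult.commute)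
  then have "(q ^ n1) ^ n = 1" by (simp add: qn)
  note ord = mult_order_dvd[OF n this, folded assms(14)]
  have cases: "2 * t \<le> n \<or> t = n \<and> g \<noteq> 0"
  proof -
    obtain d where d: "n = t * d" using ord(3) by blast
    have "g \<noteq> 0" using assms(6,9) n by (auto simp: power_0_left)
    moreover have "2 * t \<le> n" if "t \<noteq> n"
    proof -
      have "d \<noteq> 0" "d \<noteq> 1" using d n that by auto
      then have "2 \<le> d" by linarith
      then have "t * 2 \<le> t * d" by (rule mult_le_mono2)
      then show ?thesis using d by linarith
    qed
    ultimately show ?thesis by blast
  qed
  obtain m m' where
    "V_module M (quotient_act ?I M) t m n n1 q \<beta>1 \<beta>2 \<beta>3 g \<gamma>2 \<gamma>3 (i - int t + int n)"
    "V_module N (quotient_act ?I N) t m' n n1 q \<beta>1 \<beta>2 \<beta>3 g \<gamma>2 \<gamma>3 i"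
    using is_V_module_imp_V_module[OF assms(17) ord(1)] is_V_module_imp_V_module[OF assms(18) ord(1)]
    by metis
  moreover have "q ^ (t * n1) = 1"
    using ord(2) by (simp only: power_mult[symmetric] mult.commute)
  ultimately interpret V_pair M "quotient_act ?I M" N "quotient_act ?I N" t m m' n n1 q \<beta>1 \<beta>2 \<beta>3 g \<gamma>2 \<gamma>3 i
    using qn n by (intro V_pair.intro V_pair_axioms.intro)
  obtain \<delta> p where crossed: "free_crossed M (quotient_act ?I M) N (quotient_act ?I N) \<delta>"
    and rel: "\<And>r v. \<lbrakk>r \<in> H_relators n n1 q \<beta>1 \<beta>2 \<beta>3; v \<in> carrier M\<rbrakk> \<Longrightarrow>
      free_crossed.crossed (quotient_act ?I M) N (quotient_act ?I N) \<delta> r v = \<zero>\<^bsub>N\<^esub>"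
    and p: "quotient_act ?I M p (m 0) = \<zero>\<^bsub>M\<^esub>"
    and nonsplit: "\<And>w. w \<in> carrier N \<Longrightarrow>
      free_crossed.crossed (quotient_act ?I M) N (quotient_act ?I N) \<delta> p (m 0) \<noteq> quotient_act ?I N p w"
    using exists_nonsplit_crossed[OF cases] by blast
  have modules: "left_module (free_algebra Quot ?I) M" "left_module (free_algebra Quot ?I) N"
    using assms(17,18) by (simp_all add: is_V_module_def H_algebra_def)
  show ?thesis
    using Ext1_nontrivial_of_free_crossed[of "H_relators n n1 q \<beta>1 \<beta>2 \<beta>3", folded H_ideal_def,
        OF modules crossed rel M.basis_closed[OF M.t_pos] p nonsplit]
    by (simp add: H_algebra_def)
qed

end
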